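(* Consider a statistical model with parameter $\boldsymbol\theta\in\Theta\subset\mathbb R^m$. Let $\pi(\boldsymbol\theta)$ be a prior density on $\boldsymbol\theta$, possibly data dependent, and let $\Pi_n(\boldsymbol\theta\in\cdot)$ be the posterior distribution of $\boldsymbol\theta$. Assume: (a) There are sequences $\boldsymbol v_n\in(0,\infty)^m$ and $\boldsymbol\theta_n\in\mathbb R^m$ such that all components of $\boldsymbol v_n$ tend to $\infty$, $\boldsymbol\theta_n\stackrel{\mathbb P}{\to}\boldsymbol\theta_0$, and $$\sup_{B}\big|\Pi_n(\{\boldsymbol\theta:\boldsymbol v_n(\boldsymbol\theta-\boldsymbol\theta_n)\in B\})-\mathcal N(B;\boldsymbol 0,\boldsymbol D)\big|=o_{\mathbb P}(1),$$ where $B$ ranges over measurable subsets of $\mathbb R^m$ and $\boldsymbol D$ is positive definite. (b) Let $l\le m$ and let $T_n:\Theta\to\mathbb R^l$ be a sequence of continuously differentiable maps such that, for a sequence $\boldsymbol w_n\in\mathbb R^l$ and an $(l\times m)$ matrix $\boldsymbol J$ of full rank, $\nabla\overline T_n(\boldsymbol\Delta)\to\boldsymbol J$ uniformly on compact sets as $n\to\infty$, where $$\overline T_n(\boldsymbol\Delta)=\boldsymbol w_n\big(T_n(\boldsymbol\theta_n+\boldsymbol v_n^{-1}\boldsymbol\Delta)-T_n(\boldsymbol\theta_n)\big),\qquad\boldsymbol\Delta\in\mathbb R^m.$$ Then $$\sup_{B\subset\mathbb R^l}\big|\Pi_n(\{\boldsymbol\theta:\boldsymbol w_n(T_n(\boldsymbol\theta)-T_n(\boldsymbol\theta_n))\in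 B\})-\mathcal N(B;\boldsymbol0,\boldsymbol J\boldsymbol D\boldsymbol J^\top)\big|=o_{\mathbb P}(1),$$ where $B$ ranges over measurable subsets of $\mathbb R^l$.
   Context: Products and inverses of vectors, such as $\boldsymbol v_n(\boldsymbol\theta-\boldsymbol\theta_n)$, $\boldsymbol v_n^{-1}\boldsymbol\Delta$ and $\boldsymbol w_n(\cdot)$, are componentwise. $\nabla\overline T_n$ denotes the $(l\times m)$ Jacobian matrix. $\mathcal N(\cdot;\boldsymbol\mu,\boldsymbol S)$ is the normal probability measure with mean $\boldsymbol\mu$ and covariance $\boldsymbol S$. $\boldsymbol\theta_n$ may be random (data dependent), in which case the uniform convergence on compact sets in (b) is understood in probability; hypothesis (b) presupposes that $\overline T_n$ is defined on any given compact set for large $n$ (with probability tending to one). *)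

theory Defs
  imports "HOL-Probability.Probability"
begin

section \<open>Asymptotics in probability\<close>

text \<open>
  The data of stage \<open>n\<close> are a point \<open>x\<close> of \<open>space (M n)\<close>, distributed according to the
  probability measure \<open>M n\<close>. Probabilities of exceptional events are outer probabilities. They
  agree with \<open>emeasure (M n)\<close> on measurable events, whereas \<open>emeasure\<close> of a non-measurable
  event is 0 by convention, which would make such events vanish for free.
\<close>

definition vanishing_prob :: "(nat \<Rightarrow> 'a measure) \<Rightarrow> (nat \<Rightarrow> 'a \<Rightarrow> bool) \<Rightarrow> bool" where
  "vanishing_prob M A \<longleftrightarrow>
     (\<lambda>n. outer_measure_of (M n) {x \<in> space (M n). A n x}) \<longlonglongrightarrow> 0"

definition tendsto_in_prob ::
  "(nat \<Rightarrow> 'a measure) \<Rightarrow> (nat \<Rightarrow> 'a \<Rightarrow> 'b::metric_space) \<Rightarrow> 'b \<Rightarrow> bool" where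
  "tendsto_in_prob M X c \<longleftrightarrow> (\<forall>e>0. vanishing_prob M (\<lambda>n x. dist (X n x) c > e))"

text \<open>
  The event below is \<open>sup\<^sub>s dist (f n x s) (l s) > e\<close>, the supremum being over \<open>s \<in> S\<close>, with no
  convention needed for an infinite supremum.
\<close>

definition uniform_limit_in_prob ::
  "(nat \<Rightarrow> 'a measure) \<Rightarrow> 's set \<Rightarrow> (nat \<Rightarrow> 'a \<Rightarrow> 's \<Rightarrow> 'b::metric_space) \<Rightarrow> ('s \<Rightarrow> 'b) \<Rightarrow> bool" where
  "uniform_limit_in_prob M S f l \<longleftrightarrow>
     (\<forall>e>0. vanishing_prob M (\<lambda>n x. \<exists>s\<in>S. dist (f n x s) (l s) > e))"


section \<open>Normal distributions\<close>

definition pos_def_matrix :: "real^'n^'n \<Rightarrow> bool" where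
  "pos_def_matrix S \<longleftrightarrow> transpose S = S \<and> (\<forall>x. x \<noteq> 0 \<longrightarrow> x \<bullet> (S *v x) > 0)"

text \<open>The normal law through its Lebesgue density; meaningful for positive definite \<open>S\<close> only.\<close>

definition mv_normal :: "real^'n \<Rightarrow> real^'n^'n \<Rightarrow> (real^'n) measure" where
  "mv_normal \<mu> S = density lborel (\<lambda>x. ennreal
     (exp (- ((x - \<mu>) \<bullet> (matrix_inv S *v (x - \<mu>))) / 2) / sqrt ((2 * pi) ^ CARD('n) * det S)))"


section \<open>Posterior distributions\<close>

text \<open>
  Bayes' formula for one observation: \<open>L\<close> is the likelihood and \<open>q\<close> the prior density with respect
  to Lebesgue measure, both as functions of the parameter in \<open>\<Theta>\<close>. This is a probability measure
  whenever the normalising integral lies strictly between 0 and infinity. If the integral is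
  infinite, the result is the zero measure because \<open>c / \<infinity> = 0\<close>; if it is 0, the numerator is 0
  almost everywhere and \<open>0 / 0 = 0\<close>, so the result is the zero measure as well.
\<close>

definition posterior ::
  "(real^'m) set \<Rightarrow> (real^'m \<Rightarrow> real) \<Rightarrow> (real^'m \<Rightarrow> real) \<Rightarrow> (real^'m) measure" where
  "posterior \<Theta> L q = density lborel (\<lambda>\<theta>.
     (ennreal (L \<theta> * q \<theta>) * indicator \<Theta> \<theta>) / (\<integral>\<^sup>+\<eta>\<in>\<Theta>. ennreal (L \<eta> * q \<eta>) \<partial>lborel))"

text \<open>
  A statistical model: for each parameter in \<open>\<Theta>\<close> the function \<open>p \<theta>\<close> is a probability density with
  respect to a common \<open>\<sigma>\<close>-finite measure \<open>\<nu>\<close>.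
\<close>

definition dominated_model ::
  "(real^'m) set \<Rightarrow> 'a measure \<Rightarrow> (real^'m \<Rightarrow> 'a \<Rightarrow> real) \<Rightarrow> bool" where
  "dominated_model \<Theta> \<nu> p \<longleftrightarrow>
     sigma_finite_measure \<nu> \<and>
     (\<lambda>(\<theta>, x). p \<theta> x) \<in> borel_measurable (restrict_space borel \<Theta> \<Otimes>\<^sub>M \<nu>) \<and>
     (\<forall>\<theta>\<in>\<Theta>. \<forall>x\<in>space \<nu>. p \<theta> x \<ge> 0) \<and>
     (\<forall>\<theta>\<in>\<Theta>. prob_space (density \<nu> (\<lambda>x. ennreal (p \<theta> x))))"

text \<open>
  A prior density that may depend on the data \<open>x\<close>. It is not required to integrate to one, so
  improper priors are covered as well.
\<close>

definition prior_density ::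
  "(real^'m) set \<Rightarrow> 'a measure \<Rightarrow> (real^'m \<Rightarrow> 'a \<Rightarrow> real) \<Rightarrow> bool" where
  "prior_density \<Theta> \<nu> q \<longleftrightarrow>
     (\<lambda>(\<theta>, x). q \<theta> x) \<in> borel_measurable (restrict_space borel \<Theta> \<Otimes>\<^sub>M \<nu>) \<and>
     (\<forall>\<theta>\<in>\<Theta>. \<forall>x\<in>space \<nu>. q \<theta> x \<ge> 0)"


section \<open>Smooth maps and their rescaling\<close>

text \<open>
  Derivatives are taken within \<open>\<Theta>\<close>, so that no openness of \<open>\<Theta>\<close> is needed; at interior points they
  are the usual ones.
\<close>

definition continuously_differentiable_on ::
  "(real^'m \<Rightarrow> real^'l) \<Rightarrow> (real^'m) set \<Rightarrow> bool" where
  "continuously_differentiable_on f \<Theta> \<longleftrightarrow>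
     (\<exists>f' :: real^'m \<Rightarrow> real^'m^'l. continuous_on \<Theta> f' \<and>
        (\<forall>\<theta>\<in>\<Theta>. (f has_derivative (\<lambda>h. f' \<theta> *v h)) (at \<theta> within \<Theta>)))"

text \<open>Products \<open>*\<close> of vectors are componentwise.\<close>

definition localize :: "real^'m \<Rightarrow> real^'m \<Rightarrow> real^'m \<Rightarrow> real^'m" where
  "localize v \<theta>n \<Delta> = \<theta>n + (\<chi> i. inverse (v $ i)) * \<Delta>"

definition rescaled_map ::
  "real^'l \<Rightarrow> real^'m \<Rightarrow> (real^'m \<Rightarrow> real^'l) \<Rightarrow> real^'m \<Rightarrow> real^'m \<Rightarrow> real^'l" where
  "rescaled_map w v T \<theta>n \<Delta> = w * (T (localize v \<theta>n \<Delta>) - T \<theta>n)"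

end

theory Submission
  imports Defs
begin

text \<open>
  In the localised coordinate \<open>\<Delta> = v\<^sub>n (\<theta> - \<theta>\<^sub>n)\<close> the quantity of interest is \<open>F \<Delta>\<close>, where \<open>F\<close> is the
  rescaled map. The law of \<open>\<Delta>\<close> is close to a normal law \<open>N\<close> in total variation, and images under a
  common map are no farther apart. So it must be shown that \<open>F\<close> and its limiting derivative \<open>J\<close> map \<open>N\<close>
  to nearly the same law, and that \<open>J\<close> maps \<open>N\<close> to the normal law with covariance \<open>J D J\<^sup>T\<close>.

  For the first point, let \<open>J'\<close> be a right inverse of \<open>J\<close>. Then \<open>F = J \<circ> H\<close> with
  \<open>H x = x + J' (F x - J x)\<close>, and since \<open>F\<close> fixes the origin and its derivative is uniformly close to \<open>J\<close>
  on a large ball, \<open>H\<close> is on this ball the identity plus a map with small Lipschitz constant. Such a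
  map distorts volumes and the normal density by factors close to 1
  (\<open>mv_normal_near_identity\<close>), so \<open>F\<close> puts hardly more mass on any set than \<open>J\<close> does
  (\<open>mv_normal_near_linear\<close>). The dimension never has to be split into
  \<open>l\<close> and \<open>m - l\<close>, and surjectivity of \<open>H\<close> is not an issue: excess mass on a set is bounded
  directly, missing mass by way of the complement (\<open>transfer_of_laws\<close>). The bound on volumes needs
  no determinant either, only that the inverse of \<open>H\<close> is nearly a contraction, by a Vitali covering
  argument (\<open>emeasure_lborel_le_expanding_image\<close>).

  For the second point, write \<open>D = A A\<^sup>T\<close> by diagonalisation, so that \<open>N\<close> is the image of the standard
  normal law under \<open>A\<close>. Then \<open>J A = R U\<close> where \<open>R\<close> is invertible and \<open>U\<close> has orthonormal rows. Up to a
  rotation \<open>U\<close> is a selection of coordinates, so it maps the standard normal law to a standard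
  normal law (\<open>distr_mv_normal_linear\<close>).

  The resulting estimate (\<open>delta_method_total_variation\<close>) is deterministic and uniform, so it holds for
  all data outside the union of three events of vanishing probability: the localised posterior
  is far from \<open>N\<close>, the localised ball is not contained in \<open>\<Theta>\<close>, or the Jacobian is far from \<open>J\<close> somewhere on
  the ball.
\<close>

section \<open>Vanishing probabilities\<close>

lemma outer_measure_of_Un_le:
  assumes "A \<subseteq> space M" "B \<subseteq> space M"
  shows "outer_measure_of M (A \<union> B) \<le> outer_measure_of M A + outer_measure_of M B"
proof -
  obtain E F where E: "E \<in> sets M" "A \<subseteq> E" "outer_measure_of M A = emeasure M E"
    and F: "F \<in> sets M" "B \<subseteq> F" "outer_measure_of M B = emeasure M F"
    using outer_measure_of_attain[OF assms(1)] outer_measure_of_attain[OF assms(2)] by blast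
  have "outer_measure_of M (A \<union> B) \<le> outer_measure_of M (E \<union> F)"
    using E F by (intro outer_measure_of_mono) auto
  also have "\<dots> \<le> emeasure M E + emeasure M F"
    using E F by (simp add: emeasure_subadditive)
  finally show ?thesis using E F by simp
qed

text \<open>
  The supremum of total variation errors over uncountably many sets need not be a measurable function
  of the data, so asymptotic smallness is always derived by covering a bad event with others.
\<close>

lemma vanishing_prob_subset_Un:
  assumes "vanishing_prob M A" "vanishing_prob M B"
    and "\<And>n x. x \<in> space (M n) \<Longrightarrow> C n x \<Longrightarrow> A n x \<or> B n x"
  shows "vanishing_prob M C"
  unfolding vanishing_prob_def
proof (rule tendsto_sandwich[OF _ _ tendsto_const])
  let ?o = "\<lambda>A n. outer_measure_of (M n) {x \<in> space (M n). A n x}"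
  show "(\<lambda>n. ?o A n + ?o B n) \<longlonglongrightarrow> 0"
    using tendsto_add[OF assms(1,2)[unfolded vanishing_prob_def]] by simp
  have "?o C n \<le> ?o A n + ?o B n" for n
  proof -
    have "?o C n \<le> outer_measure_of (M n) ({x \<in> space (M n). A n x} \<union> {x \<in> space (M n). B n x})"
      using assms(3) by (intro outer_measure_of_mono) auto
    also have "\<dots> \<le> ?o A n + ?o B n" by (rule outer_measure_of_Un_le) auto
    finally show ?thesis .
  qed
  then show "\<forall>\<^sub>F n in sequentially. ?o C n \<le> ?o A n + ?o B n" by simp
qed simp

section \<open>Volume under expanding maps\<close>

text \<open>
  The inverse of \<open>H\<close> is \<open>c\<close>-Lipschitz, so it maps a ball of radius \<open>r\<close> centred in \<open>H ` S\<close> into one of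
  radius \<open>c * r\<close>, and null sets to null sets. By Vitali's covering theorem, disjoint balls of this kind
  inside an open set scarcely larger than \<open>A\<close> cover \<open>H ` S\<close> up to a null set, and their total volume
  is controlled by that of \<open>A\<close>. The lemma takes the place of the change of variables formula: it
  bounds volumes under perturbations of the identity, where \<open>c\<close> is close to 1, and
  for \<open>c = 1\<close> it shows that isometries preserve Lebesgue measure.
\<close>

lemma emeasure_lborel_le_expanding_image:
  fixes H :: "'a::euclidean_space \<Rightarrow> 'a"
  assumes S: "S \<in> sets borel" and A: "A \<in> sets borel" and sub: "H ` S \<subseteq> A" and c: "c > 0"
    and expand: "\<And>x y. x \<in> S \<Longrightarrow> y \<in> S \<Longrightarrow> norm (x - y) \<le> c * norm (H x - H y)"
  shows "emeasure lborel S \<le> ennreal (c ^ DIM('a)) * emeasure lborel A"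
proof (rule ennreal_le_epsilon)
  fix e :: real assume "e > 0"
  let ?n = "DIM('a)"
  have inj: "inj_on H S"
    using expand by (force intro!: inj_onI)
  have "e / c ^ ?n > 0" using \<open>e > 0\<close> c by simp
  then obtain U where U: "open U" "A \<subseteq> U" "emeasure lborel (U - A) < ennreal (e / c ^ ?n)"
    using outer_regular_lborel[OF A] by blast
  have "emeasure lborel U \<le> emeasure lborel A + emeasure lborel (U - A)"
    using emeasure_subadditive[of A lborel "U - A"] U(1,2) A by (simp add: Un_absorb1)
  also have "\<dots> \<le> emeasure lborel A + ennreal (e / c ^ ?n)"
    using U(3) by (intro add_left_mono) simp
  finally have mU: "emeasure lborel U \<le> emeasure lborel A + ennreal (e / c ^ ?n)" .

  define K where "K = {(a, r). a \<in> H ` S \<and> 0 < r \<and> cball a r \<subseteq> U}"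
  have "\<exists>i. i \<in> K \<and> y \<in> cball (fst i) (snd i) \<and> snd i < d" if "y \<in> H ` S" "0 < d" for y d
  proof -
    obtain r where r: "r > 0" "cball y r \<subseteq> U"
      using U(1,2) sub \<open>y \<in> H ` S\<close> by (meson open_contains_cball subsetD)
    have "(y, min r (d/2)) \<in> K"
      using r that by (auto simp: K_def)
    moreover have "y \<in> cball y (min r (d/2))" "min r (d/2) < d" using r that by auto
    ultimately show ?thesis by force
  qed
  note fine = this
  have pos: "\<And>i. i \<in> K \<Longrightarrow> 0 < snd i" by (auto simp: K_def)
  obtain C where C: "countable C" "C \<subseteq> K"
     and dis: "pairwise (\<lambda>i j. disjnt (cball (fst i) (snd i)) (cball (fst j) (snd j))) C"
     and neg: "negligible (H ` S - (\<Union>i \<in> C. cball (fst i) (snd i)))"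
    by (rule Vitali_covering_theorem_cballs[where a=fst and r=snd, OF pos fine])
  define g where "g = inv_into S H"
  define N where "N = H ` S - (\<Union>i \<in> C. cball (fst i) (snd i))"
  have g: "g y \<in> S" "H (g y) = y" if "y \<in> H ` S" for y
    using that by (auto simp: g_def inv_into_into f_inv_into_f)
  \<comment> \<open>The part of \<open>H ` S\<close> that the balls miss.\<close>
  have "negligible (g ` N)"
  proof (rule negligible_locally_Lipschitz_image)
    fix x assume x: "x \<in> N"
    have "norm (g y - g x) \<le> c * norm (y - x)" if "y \<in> N" for y
      using expand[of "g y" "g x"] g x that by (auto simp: N_def)
    then show "\<exists>T B. open T \<and> x \<in> T \<and> (\<forall>y \<in> N \<inter> T. norm (g y - g x) \<le> B * norm (y - x))"
      by (intro exI[of _ UNIV]) auto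
  qed (use neg in \<open>simp_all add: N_def\<close>)
  then have gN: "g ` N \<in> null_sets lebesgue"
    by (simp add: negligible_iff_null_sets)

  \<comment> \<open>The balls are enumerated by natural numbers, with empty sets at the numbers that encode none:
    \<open>Q\<close> lists the covering balls and \<open>P\<close> the larger balls that contain their preimages.\<close>
  define t where "t = to_nat_on C"
  define b where "b = (\<lambda>n. inv_into C t n)"
  have tinj: "inj_on t C" using C(1) by (simp add: t_def inj_on_to_nat_on)
  have b: "b n \<in> C" if "n \<in> t ` C" for n using that by (simp add: b_def inv_into_into)
  have bt: "b (t i) = i" if "i \<in> C" for i using that tinj by (simp add: b_def)
  define P where "P = (\<lambda>n. if n \<in> t ` C then cball (g (fst (b n))) (c * snd (b n)) else {})"
  define Q where "Q = (\<lambda>n. if n \<in> t ` C then cball (fst (b n)) (snd (b n)) else {})"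
  have cover: "S \<subseteq> (\<Union>n. P n) \<union> g ` N"
  proof
    fix x assume x: "x \<in> S"
    show "x \<in> (\<Union>n. P n) \<union> g ` N"
    proof (cases "H x \<in> N")
      case True
      moreover have "g (H x) = x" using x inj by (simp add: g_def)
      ultimately show ?thesis by force
    next
      case False
      then obtain i where i: "i \<in> C" "H x \<in> cball (fst i) (snd i)"
        using x by (auto simp: N_def)
      have "fst i \<in> H ` S" using i(1) C(2) by (auto simp: K_def)
      then have "norm (g (fst i) - x) \<le> c * norm (fst i - H x)"
        using expand[of "g (fst i)" x] g x by simp
      also have "\<dots> \<le> c * snd i"
        using i(2) c by (simp add: dist_norm)
      finally have "x \<in> P (t i)" using i(1) bt by (simp add: P_def dist_norm)
      then show ?thesis by blast
    qed
  qed
  have "disjoint_family Q"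
    unfolding disjoint_family_on_def
  proof (intro ballI impI)
    fix m n :: nat assume "m \<noteq> n"
    show "Q m \<inter> Q n = {}"
    proof (cases "m \<in> t ` C \<and> n \<in> t ` C")
      case True
      then have "b m \<noteq> b n" using \<open>m \<noteq> n\<close> bt by auto
      then show ?thesis using True dis b by (auto simp: Q_def pairwise_def disjnt_def)
    qed (auto simp: Q_def)
  qed
  have PQ: "emeasure lborel (P n) = ennreal (c ^ ?n) * emeasure lborel (Q n)" for n
  proof (cases "n \<in> t ` C")
    case True
    then have "snd (b n) > 0" using b C(2) by (force simp: K_def)
    then show ?thesis using True c
      by (simp add: P_def Q_def emeasure_cball power_mult_distrib mult_ac unit_ball_vol_nonneg
            flip: ennreal_mult)
  qed (simp add: P_def Q_def)
  have Pm [measurable]: "P n \<in> sets borel" and Qm [measurable]: "Q n \<in> sets borel" for n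
    by (simp_all add: P_def Q_def)
  have QU: "Q n \<subseteq> U" for n
    using C(2) b[of n] by (cases "b n") (auto simp: Q_def K_def)
  have "(\<Sum>n. emeasure lborel (Q n)) = emeasure lborel (\<Union>n. Q n)"
    using \<open>disjoint_family Q\<close> by (intro suminf_emeasure) auto
  also have "\<dots> \<le> emeasure lborel U"
    using QU U(1) by (intro emeasure_mono) auto
  finally have sumQ: "(\<Sum>n. emeasure lborel (Q n)) \<le> emeasure lborel U" .
  have "emeasure lborel S = emeasure lebesgue S" using S by simp
  also have "\<dots> \<le> emeasure lebesgue ((\<Union>n. P n) \<union> g ` N)"
    using cover gN by (intro emeasure_mono sets.Un) auto
  also have "\<dots> = emeasure lebesgue (\<Union>n. P n)"
    using gN by (intro emeasure_Un_null_set) auto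
  also have "\<dots> = emeasure lborel (\<Union>n. P n)" by simp
  also have "\<dots> \<le> (\<Sum>n. emeasure lborel (P n))"
    by (intro emeasure_subadditive_countably) auto
  also have "\<dots> = ennreal (c ^ ?n) * (\<Sum>n. emeasure lborel (Q n))"
    by (simp add: PQ)
  also have "\<dots> \<le> ennreal (c ^ ?n) * (emeasure lborel A + ennreal (e / c ^ ?n))"
    by (intro mult_left_mono order_trans[OF sumQ mU]) simp
  also have "\<dots> = ennreal (c ^ ?n) * emeasure lborel A + ennreal e"
    using c \<open>e > 0\<close> by (simp add: distrib_left flip: ennreal_mult)
  finally show "emeasure lborel S \<le> ennreal (c ^ ?n) * emeasure lborel A + ennreal e" .
qed

section \<open>Diagonalising symmetric matrices\<close>

lemma matrix_inv_eqI:
  fixes A B :: "real^'n^'n"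
  assumes "A ** B = mat 1"
  shows "matrix_inv A = B"
proof -
  have "\<exists>A'. A ** A' = mat 1 \<and> A' ** A = mat 1"
    using assms matrix_left_right_inverse by blast
  then have "matrix_inv A ** A = mat 1"
    unfolding matrix_inv_def by (rule someI2_ex) simp
  then have "matrix_inv A ** (A ** B) = B" by (simp add: matrix_mul_assoc)
  then show ?thesis by (simp add: assms)
qed

definition diagonal_matrix :: "real^'n \<Rightarrow> real^'n^'n" where
  "diagonal_matrix s = (\<chi> i j. if i = j then s $ i else 0)"

lemma diagonal_matrix_vector: "diagonal_matrix s *v x = s * x"
  by (simp add: diagonal_matrix_def matrix_vector_mult_def vec_eq_iff if_distrib[of "\<lambda>z. z * _"]
      sum.delta cong: if_cong)

lemma diagonal_matrix_mult: "diagonal_matrix s ** diagonal_matrix t = diagonal_matrix (s * t)"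
  by (simp add: matrix_eq diagonal_matrix_vector mult.assoc flip: matrix_vector_mul_assoc)

lemma transpose_diagonal_matrix: "transpose (diagonal_matrix s) = diagonal_matrix s"
  by (simp add: diagonal_matrix_def transpose_def vec_eq_iff)

lemma det_diagonal_matrix: "det (diagonal_matrix s) = (\<Prod>i\<in>UNIV. s $ i)"
  by (subst det_diagonal) (simp_all add: diagonal_matrix_def)

lemma symmetric_matrix_inner:
  fixes S :: "real^'n^'n"
  assumes "transpose S = S"
  shows "x \<bullet> (S *v y) = (S *v x) \<bullet> y"
  by (metis assms dot_lmul_matrix vector_transpose_matrix)

text \<open>
  A maximiser \<open>u\<close> of the quadratic form on the unit sphere of \<open>V\<close>, with maximum \<open>l\<close>, is an eigenvector.
  Indeed \<open>y \<bullet> (S *v y) \<le> l * (y \<bullet> y)\<close> on \<open>V\<close> with equality at \<open>u\<close>, so the first-order term of the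
  difference at \<open>u\<close> vanishes in every direction of \<open>V\<close>, in particular in the direction \<open>l *\<^sub>R u - S *v u\<close>.
\<close>

lemma symmetric_matrix_eigenvector:
  fixes S :: "real^'n^'n"
  assumes S: "transpose S = S" and V: "subspace V" "\<And>x. x \<in> V \<Longrightarrow> S *v x \<in> V"
    and nontriv: "a \<in> V" "a \<noteq> 0"
  obtains u l where "u \<in> V" "norm u = 1" "S *v u = l *\<^sub>R u"
proof -
  let ?K = "sphere 0 1 \<inter> V"
  have "compact ?K" using V(1) by (simp add: closed_subspace compact_Int_closed)
  moreover have "a /\<^sub>R norm a \<in> ?K"
    using nontriv V(1) by (simp add: subspace_scale)
  moreover have "continuous_on ?K (\<lambda>x. x \<bullet> (S *v x))"
    by (intro continuous_intros linear_continuous_on_compose matrix_vector_mul_linear) 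
  ultimately obtain u where u: "u \<in> ?K" and max: "\<And>y. y \<in> ?K \<Longrightarrow> y \<bullet> (S *v y) \<le> u \<bullet> (S *v u)"
    using continuous_attains_sup[of ?K "\<lambda>x. x \<bullet> (S *v x)"] by blast
  define l where "l = u \<bullet> (S *v u)"
  have quad: "y \<bullet> (S *v y) \<le> l * (y \<bullet> y)" if "y \<in> V" for y
  proof (cases "y = 0")
    case False
    have "(y /\<^sub>R norm y) \<bullet> (S *v (y /\<^sub>R norm y)) \<le> l"
      using max[of "y /\<^sub>R norm y"] that False V(1) by (simp add: subspace_scale l_def)
    then have "(y \<bullet> (S *v y)) / (norm y)\<^sup>2 \<le> l"
      by (simp add: matrix_vector_mult_scaleR power2_eq_square divide_inverse mult_ac)
    then show ?thesis using False by (simp add: divide_le_eq dot_square_norm)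
  qed simp
  define h where "h = l *\<^sub>R u - S *v u"
  have hV: "h \<in> V" using u V by (auto simp: h_def intro!: subspace_diff subspace_scale)
  have uu: "u \<bullet> u = 1" using u by (simp add: dot_square_norm)
  define c where "c = l * (h \<bullet> h) - h \<bullet> (S *v h)"
  have small: "2 * t * (h \<bullet> h) \<le> t\<^sup>2 * c" for t
  proof -
    have "u - t *\<^sub>R h \<in> V" using u hV V(1) by (auto intro!: subspace_diff subspace_scale)
    from quad[OF this]
    have "l - 2 * t * (h \<bullet> (S *v u)) + t\<^sup>2 * (h \<bullet> (S *v h)) \<le> l * (1 - 2 * t * (h \<bullet> u) + t\<^sup>2 * (h \<bullet> h))"
      using symmetric_matrix_inner[OF S, of u h]
      by (simp add: matrix_vector_mult_diff_distrib matrix_vector_mult_scaleR inner_diff_left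
          inner_diff_right l_def uu inner_commute power2_eq_square algebra_simps)
    then have "2 * t * (l * (h \<bullet> u)) - 2 * t * (h \<bullet> (S *v u)) \<le> t\<^sup>2 * (l * (h \<bullet> h) - h \<bullet> (S *v h))"
      by (simp add: algebra_simps)
    moreover have "h \<bullet> h = l * (h \<bullet> u) - h \<bullet> (S *v u)"
      using inner_diff_right[of h "l *\<^sub>R u" "S *v u"] by (simp flip: h_def)
    then have "2 * t * (h \<bullet> h) = 2 * t * (l * (h \<bullet> u)) - 2 * t * (h \<bullet> (S *v u))"
      by (simp only: right_diff_distrib)
    ultimately show ?thesis unfolding c_def by linarith
  qed
  have "h \<bullet> h \<le> 0"
  proof (rule ccontr)
    assume "\<not> h \<bullet> h \<le> 0"
    define t where "t = (h \<bullet> h) / (\<bar>c\<bar> + 1)"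
    have "t > 0" using \<open>\<not> h \<bullet> h \<le> 0\<close> by (simp only: t_def, intro divide_pos_pos) auto
    have t: "t * (\<bar>c\<bar> + 1) = h \<bullet> h" by (simp add: t_def)
    have "t * (2 * (h \<bullet> h)) \<le> t * (t * c)"
      using small[of t] by (simp add: power2_eq_square mult_ac)
    then have "2 * (h \<bullet> h) \<le> t * c" using \<open>t > 0\<close> by simp
    also have "\<dots> \<le> t * (\<bar>c\<bar> + 1)" using \<open>t > 0\<close> by (intro mult_left_mono) auto
    finally show False using t \<open>\<not> h \<bullet> h \<le> 0\<close> by simp
  qed
  then have "h = 0" using inner_ge_zero[of h] by (metis antisym inner_eq_zero_iff)
  then have "S *v u = l *\<^sub>R u" by (simp add: h_def)
  then show thesis using that u by auto
qed

text \<open>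
  A largest orthonormal set of eigenvectors spans the space: otherwise its orthogonal complement is
  nontrivial and invariant under \<open>S\<close>, and contains a further unit eigenvector.
\<close>

lemma symmetric_matrix_diagonalization:
  fixes S :: "real^'n^'n"
  assumes S: "transpose S = S"
  obtains Q d where "orthogonal_matrix Q" "S = Q ** diagonal_matrix d ** transpose Q"
proof -
  define P where "P = (\<lambda>E. pairwise orthogonal E \<and> (\<forall>x\<in>E. norm x = 1 \<and> (\<exists>l. S *v x = l *\<^sub>R x)))"
  have indep: "independent E" if "P E" for E
    using that by (intro pairwise_orthogonal_independent) (auto simp: P_def)
  have "P {}" by (simp add: P_def)
  moreover have "\<forall>E. P E \<longrightarrow> card E \<le> DIM(real^'n)"
    using indep independent_bound by blast
  ultimately obtain E where E: "P E" and max: "\<And>F. P F \<Longrightarrow> card F \<le> card E"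
    using ex_has_greatest_nat[of P "{}" card "Suc (DIM(real^'n))"] by (auto simp: less_Suc_eq_le)
  have finE: "finite E" using indep[OF E] independent_bound by blast
  have span: "span E = UNIV"
  proof (rule ccontr)
    assume "span E \<noteq> UNIV"
    then obtain a where a: "a \<noteq> 0" "\<And>x. x \<in> span E \<Longrightarrow> a \<bullet> x = 0"
      using span_not_UNIV_orthogonal by blast
    define V where "V = {x. \<forall>e\<in>E. e \<bullet> x = 0}"
    have V: "subspace V" by (auto simp: V_def subspace_def inner_add_right)
    have "S *v x \<in> V" if "x \<in> V" for x
      unfolding V_def
    proof (intro CollectI ballI)
      fix e assume e: "e \<in> E"
      then obtain l where "S *v e = l *\<^sub>R e" using E by (auto simp: P_def)
      then show "e \<bullet> (S *v x) = 0"
        using that e by (simp add: symmetric_matrix_inner[OF S] V_def)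
    qed
    moreover have "a \<in> V" using a(2) by (auto simp: V_def inner_commute span_base)
    ultimately obtain u l where u: "u \<in> V" "norm u = 1" "S *v u = l *\<^sub>R u"
      using symmetric_matrix_eigenvector[OF S V] a(1) by metis
    have "P (insert u E)"
      using E u by (auto simp: P_def pairwise_insert V_def orthogonal_def inner_commute)
    moreover have "u \<notin> E" using u by (auto simp: V_def)
    ultimately show False using max[of "insert u E"] finE by simp
  qed
  have "card E = CARD('n)"
    by (metis dim_eq_card_independent[OF indep[OF E]] dim_span span dim_UNIV DIM_cart DIM_real mult.right_neutral)
  then obtain f :: "'n \<Rightarrow> real^'n" where f: "bij_betw f UNIV E"
    using finite_same_card_bij[of "UNIV :: 'n set" E] finE by auto
  have fE: "f i \<in> E" for i using f bij_betwE by blast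
  then have "\<exists>l. S *v f i = l *\<^sub>R f i" for i using E by (simp add: P_def)
  then obtain d where d: "\<And>i. S *v f i = d i *\<^sub>R f i" by metis
  define Q :: "real^'n^'n" where "Q = (\<chi> i j. f j $ i)"
  have col: "column j Q = f j" for j by (simp add: column_def Q_def vec_eq_iff)
  have "orthogonal (f i) (f j)" if "i \<noteq> j" for i j
  proof -
    have "pairwise orthogonal E" using E by (simp add: P_def)
    then show ?thesis using fE f that by (metis pairwiseD bij_betw_imp_inj_on injD)
  qed
  moreover have "norm (f i) = 1" for i using E fE by (simp add: P_def)
  ultimately have Q: "orthogonal_matrix Q"
    by (simp add: orthogonal_matrix_orthonormal_columns col)
  have "(S ** Q) $ i $ j = (Q ** diagonal_matrix (\<chi> i. d i)) $ i $ j" for i j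
  proof -
    have "(S ** Q) $ i $ j = (S *v f j) $ i"
      by (simp add: matrix_matrix_mult_def matrix_vector_mult_def Q_def)
    also have "\<dots> = (Q ** diagonal_matrix (\<chi> i. d i)) $ i $ j"
      by (simp add: d matrix_matrix_mult_def diagonal_matrix_def Q_def if_distrib[of "\<lambda>z. _ * z"]
          sum.delta' mult.commute cong: if_cong)
    finally show ?thesis .
  qed
  then have "S ** Q = Q ** diagonal_matrix (\<chi> i. d i)" by (simp add: vec_eq_iff)
  then have "S ** (Q ** transpose Q) = Q ** diagonal_matrix (\<chi> i. d i) ** transpose Q"
    by (simp add: matrix_mul_assoc)
  then show thesis using that[OF Q] Q by (simp add: orthogonal_matrix_def)
qed

text \<open>
  A square root of \<open>S\<close> up to transposition. The factor is chosen as a rotation after a scaling of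
  the coordinates because the effect of these two maps on Lebesgue measure is easy to determine.
\<close>

lemma pos_def_matrix_factorization:
  fixes S :: "real^'n^'n"
  assumes S: "pos_def_matrix S"
  obtains Q s where "orthogonal_matrix Q" "\<And>i. s $ i > 0"
    "S = (Q ** diagonal_matrix s) ** transpose (Q ** diagonal_matrix s)"
proof -
  obtain Q d where Q: "orthogonal_matrix Q" and Sd: "S = Q ** diagonal_matrix d ** transpose Q"
    using symmetric_matrix_diagonalization S by (metis pos_def_matrix_def)
  have QQ: "transpose Q ** Q = mat 1" using Q by (simp add: orthogonal_matrix_def)
  have d: "d $ i > 0" for i
  proof -
    let ?e = "axis i 1 :: real^'n"
    have eq: "transpose Q *v (Q *v ?e) = ?e"
      by (simp add: matrix_vector_mul_assoc QQ)
    then have "Q *v ?e \<noteq> 0" by (metis axis_eq_0_iff matrix_vector_mult_0_right zero_neq_one)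
    then have "0 < (Q *v ?e) \<bullet> (S *v (Q *v ?e))" using S by (simp add: pos_def_matrix_def)
    also have "S *v (Q *v ?e) = Q *v (diagonal_matrix d *v ?e)"
      by (simp add: Sd matrix_vector_mul_assoc QQ flip: matrix_mul_assoc)
    also have "(Q *v ?e) \<bullet> \<dots> = (transpose Q *v (Q *v ?e)) \<bullet> (diagonal_matrix d *v ?e)"
      by (metis dot_lmul_matrix vector_transpose_matrix transpose_transpose)
    also have "\<dots> = d $ i"
      by (simp only: eq) (simp add: diagonal_matrix_vector inner_axis')
    finally show ?thesis .
  qed
  \<comment> \<open>The entries of \<open>d\<close> are the values of the quadratic form at the columns of \<open>Q\<close>, hence positive.\<close>
  define s :: "real^'n" where "s = (\<chi> i. sqrt (d $ i))"
  have "s * s = d" using d by (simp add: s_def vec_eq_iff less_imp_le)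
  have "(Q ** diagonal_matrix s) ** transpose (Q ** diagonal_matrix s)
      = Q ** (diagonal_matrix s ** diagonal_matrix s) ** transpose Q"
    by (simp add: matrix_transpose_mul transpose_diagonal_matrix matrix_mul_assoc)
  also have "\<dots> = S" by (simp only: diagonal_matrix_mult \<open>s * s = d\<close> Sd)
  finally show thesis using that[OF Q, of s] d by (simp add: s_def)
qed

text \<open>
  The rows of \<open>U\<close> are orthonormal and can be completed to an orthonormal basis. In these coordinates \<open>U\<close>
  merely selects some components, in places given by \<open>e\<close>.
\<close>

lemma coisometry_extend_orthogonal:
  fixes U :: "real^'m^'l"
  assumes U: "U ** transpose U = mat 1"
  obtains Q :: "real^'m^'m" and e :: "'l \<Rightarrow> 'm"
  where "orthogonal_matrix Q" "inj e" "\<And>i. Q $ e i = U $ i"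
proof -
  have inner: "U $ i \<bullet> U $ j = (if i = j then 1 else 0)" for i j
  proof -
    have "U $ i \<bullet> U $ j = (U ** transpose U) $ i $ j"
      by (simp add: matrix_matrix_mult_def transpose_def inner_vec_def)
    then show ?thesis by (simp add: U mat_def)
  qed
  have injU: "inj (($) U)"
  proof (rule injI)
    fix i j assume "U $ i = U $ j"
    then show "i = j" using inner[of i j] inner[of i i] by (metis zero_neq_one)
  qed
  let ?R = "range (($) U)"
  have "pairwise orthogonal ?R"
    by (auto simp: pairwise_def orthogonal_def inner)
  then obtain W where W: "W \<inter> insert 0 ?R = {}" "pairwise orthogonal (?R \<union> W)"
      "span (?R \<union> W) = span (?R \<union> UNIV)"
    using orthogonal_extension_strong[where T=UNIV] by metis
  have nz: "x \<noteq> 0" if "x \<in> ?R \<union> W" for x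
    using that W(1) inner by (auto simp: disjoint_iff) (metis inner_zero_left zero_neq_one)
  then have ind: "independent (?R \<union> W)"
    using W(2) by (intro pairwise_orthogonal_independent) auto
  have fin: "finite (?R \<union> W)" using ind independent_bound by blast
  have "card (?R \<union> W) = CARD('m)"
    using basis_card_eq_dim[of "?R \<union> W" UNIV] ind W(3) by simp
  then obtain f :: "'m \<Rightarrow> real^'m" where f: "bij_betw f UNIV (?R \<union> W)"
    using finite_same_card_bij[of "UNIV :: 'm set" "?R \<union> W"] fin by auto
  define Q :: "real^'m^'m" where "Q = (\<chi> j. f j /\<^sub>R norm (f j))"
  have fR: "f i \<in> ?R \<union> W" for i using f bij_betwE by blast
  have row: "row i Q = f i /\<^sub>R norm (f i)" for i by (simp add: Q_def row_def vec_eq_iff)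
  have "orthogonal (f i) (f j)" if "i \<noteq> j" for i j
    using W(2) fR[of i] fR[of j] f that by (metis pairwiseD bij_betw_imp_inj_on injD)
  then have "orthogonal_matrix Q"
    using nz[OF fR] by (auto simp: orthogonal_matrix_orthonormal_rows row orthogonal_def)
  moreover define e where "e = (\<lambda>i. inv f (U $ i))"
  have fe: "f (e i) = U $ i" for i
    unfolding e_def using f by (intro f_inv_into_f) (auto simp: bij_betw_def)
  then have "inj e" using injU by (metis injD injI)
  moreover have "Q $ e i = U $ i" for i
    using inner[of i i] by (simp add: Q_def fe norm_eq_sqrt_inner)
  ultimately show thesis using that by blast
qed

section \<open>Linear images of normal laws\<close>

lemma distr_lborel_orthogonal:
  fixes f :: "'a::euclidean_space \<Rightarrow> 'a"
  assumes f: "orthogonal_transformation f"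
  shows "distr lborel borel f = lborel"
proof (rule measure_eqI)
  have "linear f" using f by (simp add: orthogonal_transformation_def)
  then have fm: "f \<in> borel_measurable borel"
    by (intro borel_measurable_continuous_onI linear_continuous_on linear_conv_bounded_linear[THEN iffD1])
  fix A assume "A \<in> sets (distr lborel borel f)"
  then have A: "A \<in> sets borel" by simp
  have fA: "f -` A \<in> sets borel" using measurable_sets[OF fm A] by simp
  have iso: "norm (x - y) = norm (f x - f y)" for x y
    using f \<open>linear f\<close> by (simp add: orthogonal_transformation_norm flip: linear_diff)
  have bij: "bij f" using f by (rule orthogonal_transformation_bij)
  have "emeasure lborel (f -` A) \<le> ennreal (1 ^ DIM('a)) * emeasure lborel A"
    using A fA iso by (intro emeasure_lborel_le_expanding_image[where H=f]) auto
  moreover have "emeasure lborel A \<le> ennreal (1 ^ DIM('a)) * emeasure lborel (f -` A)"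
  proof (rule emeasure_lborel_le_expanding_image[where H="inv f"])
    show "norm (x - y) \<le> 1 * norm (inv f x - inv f y)" for x y
      using iso[of "inv f x" "inv f y"] bij by (simp add: surj_f_inv_f bij_is_surj)
    show "inv f ` A \<subseteq> f -` A" using bij by (auto simp: surj_f_inv_f bij_is_surj)
  qed (use A fA in simp_all)
  ultimately show "emeasure (distr lborel borel f) A = emeasure lborel A"
    using A fm by (simp add: emeasure_distr)
qed simp

lemma borel_measurable_matrix_vector [measurable]:
  fixes A :: "real^'m^'l"
  shows "(\<lambda>x. A *v x) \<in> borel_measurable borel"
  by (intro borel_measurable_continuous_onI) (auto intro!: continuous_intros)

lemma distr_lborel_diagonal:
  fixes s :: "real^'n"
  assumes s: "\<And>i. s $ i > 0"
  shows "density (distr lborel borel ((*v) (diagonal_matrix s))) (\<lambda>_. ennreal (\<Prod>i\<in>UNIV. s $ i)) = lborel"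
proof -
  define c :: "real^'n \<Rightarrow> real" where "c b = s \<bullet> b" for b
  have Basis: "Basis = range (\<lambda>i. axis i 1 :: real^'n)" by (auto simp: Basis_vec_def)
  have inj: "inj (\<lambda>i. axis i 1 :: real^'n)" by (auto simp: inj_on_def axis_eq_axis)
  have c: "c (axis i 1) = s $ i" for i by (simp add: c_def inner_axis)
  have "(\<Sum>j\<in>Basis. (c j * (x \<bullet> j)) *\<^sub>R j) = diagonal_matrix s *v x" for x
  proof -
    have "(\<Sum>j\<in>Basis. (c j * (x \<bullet> j)) *\<^sub>R j) = (\<Sum>i\<in>UNIV. (s * x) $ i *s axis i 1)"
      by (simp add: Basis sum.reindex[OF inj] c inner_axis scalar_mult_eq_scaleR)
    then show ?thesis by (simp only: basis_expansion diagonal_matrix_vector)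
  qed
  moreover have "(\<Prod>j\<in>Basis. \<bar>c j\<bar>) = (\<Prod>i\<in>UNIV. s $ i)"
    using s by (simp add: Basis prod.reindex[OF inj] c less_imp_le)
  moreover have "c j \<noteq> 0" if j: "j \<in> Basis" for j
  proof -
    obtain i where "j = axis i 1" using j unfolding Basis by blast
    then show ?thesis using c s[of i] by simp
  qed
  ultimately show ?thesis
    using lborel_affine_euclidean[of c 0] by simp
qed

lemma mv_normal_standard:
  "mv_normal 0 (mat 1 :: real^'n^'n) =
     density lborel (\<lambda>x. ennreal (exp (- (x \<bullet> x) / 2) / sqrt ((2 * pi) ^ CARD('n))))"
proof -
  have "matrix_inv (mat 1 :: real^'n^'n) = mat 1" by (rule matrix_inv_eqI) simp
  then show ?thesis by (simp add: mv_normal_def)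
qed

lemma sets_mv_normal [simp, measurable_cong]: "sets (mv_normal \<mu> S) = sets borel"
  by (simp add: mv_normal_def)

lemma space_mv_normal [simp]: "space (mv_normal \<mu> S) = UNIV"
  by (simp add: mv_normal_def)

text \<open>
  For this shape of \<open>A\<close> the transformation of Lebesgue measure and the determinant of \<open>A ** transpose A\<close>
  are both explicit: the factor is the product of the entries of \<open>s\<close>. The density of the image is then
  read off from \<open>y \<bullet> (S\<inverse> y) = (A\<inverse> y) \<bullet> (A\<inverse> y)\<close> for \<open>S = A ** transpose A\<close>.
\<close>

lemma distr_standard_normal_scaled_rotation:
  fixes Q :: "real^'n^'n"
  assumes Q: "orthogonal_matrix Q" and s: "\<And>i. s $ i > 0"
  defines "A \<equiv> Q ** diagonal_matrix s"
  shows "distr (mv_normal 0 (mat 1)) borel ((*v) A) = mv_normal 0 (A ** transpose A)"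
proof -
  define s' :: "real^'n" where "s' = (\<chi> i. inverse (s $ i))"
  have ss: "s * s' = 1" "s' * s = 1" using s by (simp_all add: s'_def vec_eq_iff less_imp_neq[THEN not_sym])
  have one: "diagonal_matrix (1 :: real^'n) = mat 1"
    by (simp add: matrix_eq diagonal_matrix_vector)
  define A' where "A' = diagonal_matrix s' ** transpose Q"
  have QQ: "transpose Q ** Q = mat 1" "Q ** transpose Q = mat 1"
    using Q by (simp_all add: orthogonal_matrix_def)
  have "A ** A' = Q ** (diagonal_matrix s ** diagonal_matrix s') ** transpose Q"
    by (simp add: A_def A'_def matrix_mul_assoc)
  then have AA': "A ** A' = mat 1" by (simp add: diagonal_matrix_mult ss one QQ)
  then have A'A: "A' ** A = mat 1" by (simp add: matrix_left_right_inverse)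
  then have inv: "A' *v (A *v x) = x" for x by (simp add: matrix_vector_mul_assoc)
  define p where "p = (\<Prod>i\<in>UNIV. s $ i)"
  have p: "p > 0" using s by (simp add: p_def prod_pos)
  have detS: "det (A ** transpose A) = p\<^sup>2"
  proof -
    have "(det Q)\<^sup>2 = 1" using det_orthogonal_matrix[OF Q] by auto
    then show ?thesis
      by (simp add: det_mul A_def det_diagonal_matrix p_def power2_eq_square mult_ac)
  qed
  have "(A ** transpose A) ** (transpose A' ** A') = A ** transpose (A' ** A) ** A'"
    by (simp add: matrix_transpose_mul matrix_mul_assoc)
  also have "\<dots> = mat 1" by (simp add: A'A AA')
  finally have invS: "matrix_inv (A ** transpose A) = transpose A' ** A'" by (rule matrix_inv_eqI)
  have quad: "y \<bullet> ((transpose A' ** A') *v y) = (A' *v y) \<bullet> (A' *v y)" for y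
    by (metis dot_lmul_matrix matrix_vector_mul_assoc transpose_transpose vector_transpose_matrix)
  define g where "g = (\<lambda>y::real^'n. exp (- ((A' *v y) \<bullet> (A' *v y)) / 2) / sqrt ((2 * pi) ^ CARD('n)))"
  have gm [measurable]: "g \<in> borel_measurable borel" by (simp add: g_def)
  have "sqrt ((2 * pi) ^ CARD('n) * p\<^sup>2) = sqrt ((2 * pi) ^ CARD('n)) * p"
    using p by (simp add: real_sqrt_mult)
  then have dens: "mv_normal 0 (A ** transpose A) = density lborel (\<lambda>y. ennreal (g y / p))"
    by (simp add: mv_normal_def invS quad detS g_def)
  have lA: "density (distr lborel borel ((*v) A)) (\<lambda>_. ennreal p) = lborel"
  proof -
    have "orthogonal_transformation ((*v) Q)"
      using Q by (simp add: orthogonal_transformation_matrix)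
    then have "lborel = distr lborel borel ((*v) Q)" by (simp add: distr_lborel_orthogonal)
    also have "\<dots> = distr (density (distr lborel borel ((*v) (diagonal_matrix s))) (\<lambda>_. ennreal p)) borel ((*v) Q)"
      using distr_lborel_diagonal[of s] s by (simp add: p_def)
    also have "\<dots> = density (distr (distr lborel borel ((*v) (diagonal_matrix s))) borel ((*v) Q)) (\<lambda>_. ennreal p)"
      by (rule density_distr[symmetric]) simp_all
    also have "distr (distr lborel borel ((*v) (diagonal_matrix s))) borel ((*v) Q) = distr lborel borel ((*v) A)"
      by (subst distr_distr) (simp_all add: o_def A_def matrix_vector_mul_assoc)
    finally show ?thesis by simp
  qed
  show ?thesis
  proof (rule measure_eqI)
    fix B assume "B \<in> sets (distr (mv_normal 0 (mat 1)) borel ((*v) A))"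
    then have B [measurable]: "B \<in> sets borel" by simp
    have "emeasure (mv_normal 0 (A ** transpose A)) B = (\<integral>\<^sup>+y. ennreal (g y / p) * indicator B y \<partial>lborel)"
      by (simp add: dens emeasure_density)
    also have "\<dots> = (\<integral>\<^sup>+y. ennreal (g y / p) * indicator B y \<partial>density (distr lborel borel ((*v) A)) (\<lambda>_. ennreal p))"
      by (simp add: lA)
    also have "\<dots> = (\<integral>\<^sup>+y. ennreal p * (ennreal (g y / p) * indicator B y) \<partial>distr lborel borel ((*v) A))"
      by (subst nn_integral_density) simp_all
    also have "\<dots> = (\<integral>\<^sup>+y. ennreal (g y) * indicator B y \<partial>distr lborel borel ((*v) A))"
      using p by (simp add: g_def flip: mult.assoc ennreal_mult)
    also have "\<dots> = (\<integral>\<^sup>+x. ennreal (g (A *v x)) * indicator B (A *v x) \<partial>lborel)"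
      by (subst nn_integral_distr) simp_all
    also have "\<dots> = emeasure (distr (mv_normal 0 (mat 1)) borel ((*v) A)) B"
      by (simp add: emeasure_distr mv_normal_standard emeasure_density g_def inv indicator_def vimage_def)
    finally show "emeasure (distr (mv_normal 0 (mat 1)) borel ((*v) A)) B
        = emeasure (mv_normal 0 (A ** transpose A)) B" ..
  qed simp
qed

text \<open>
  The coordinates of a standard normal vector are independent because its density factorises. This
  is what makes marginal laws accessible without integrating out variables.
\<close>

lemma standard_normal_coordinates:
  "distr (mv_normal 0 (mat 1)) (Pi\<^sub>M (UNIV :: 'n::finite set) (\<lambda>_. density lborel std_normal_density)) ($)
     = Pi\<^sub>M UNIV (\<lambda>_. density lborel std_normal_density)"
  (is "?P = Pi\<^sub>M UNIV (\<lambda>_. ?N)")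
proof -
  interpret prob_space ?N by (rule prob_space_normal_density) simp
  interpret product_sigma_finite "\<lambda>_::'n. ?N" ..
  have vm: "($) \<in> mv_normal 0 (mat 1 :: real^'n^'n) \<rightarrow>\<^sub>M Pi\<^sub>M UNIV (\<lambda>_. ?N)"
    by (rule measurable_abs_UNIV) simp
  have Basis: "Basis = range (\<lambda>i. axis i 1 :: real^'n)" by (auto simp: Basis_vec_def)
  have inj: "inj (\<lambda>i. axis i 1 :: real^'n)" by (auto simp: inj_on_def axis_eq_axis)
  define idx where "idx = inv (\<lambda>i. axis i 1 :: real^'n)"
  have idx [simp]: "idx (axis i 1) = i" for i by (simp add: idx_def inv_f_f[OF inj])
  show ?thesis
  proof (rule PiM_eqI)
    fix A :: "'n \<Rightarrow> real set" assume "\<And>i. i \<in> UNIV \<Longrightarrow> A i \<in> sets ?N"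
    then have A [measurable]: "A i \<in> sets borel" for i by simp
    define f where "f b y = ennreal (std_normal_density y) * indicator (A (idx b)) y" for b y
    have "ennreal (exp (- (x \<bullet> x) / 2) / sqrt ((2 * pi) ^ CARD('n))) * indicator (($) -` Pi\<^sub>E UNIV A) x
        = (\<Prod>b\<in>Basis. f b (x \<bullet> b))" for x
    proof -
      have "(\<Prod>i\<in>UNIV. std_normal_density (x $ i))
          = (\<Prod>i\<in>(UNIV::'n set). 1 / sqrt (2 * pi)) * (\<Prod>i\<in>UNIV. exp (- (x $ i)\<^sup>2 / 2))"
        by (simp only: std_normal_density_def prod.distrib)
      also have "(\<Prod>i\<in>(UNIV::'n set). 1 / sqrt (2 * pi)) = 1 / sqrt ((2 * pi) ^ CARD('n))"
        by (simp only: prod_constant real_sqrt_power power_one_over)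
      also have "(\<Prod>i\<in>UNIV. exp (- (x $ i)\<^sup>2 / 2)) = exp (- (x \<bullet> x) / 2)"
        by (simp add: inner_vec_def sum_negf sum_divide_distrib power2_eq_square flip: exp_sum)
      finally have "(\<Prod>i\<in>UNIV. std_normal_density (x $ i))
          = exp (- (x \<bullet> x) / 2) / sqrt ((2 * pi) ^ CARD('n))" by simp
      moreover have "(indicator (($) -` Pi\<^sub>E UNIV A) x :: ennreal) = (\<Prod>i\<in>UNIV. indicator (A i) (x $ i))"
        by (auto simp: indicator_def PiE_iff prod_eq_1_iff prod_zero_iff) 
      ultimately show ?thesis
        by (simp add: Basis prod.reindex[OF inj] f_def inner_axis prod.distrib prod_ennreal)
    qed
    then have "emeasure ?P (Pi\<^sub>E UNIV A) = (\<integral>\<^sup>+x. (\<Prod>b\<in>Basis. f b (x \<bullet> b)) \<partial>(lborel :: (real^'n) measure))"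
      using vm measurable_sets[OF vm, of "Pi\<^sub>E UNIV A"]
      by (simp add: emeasure_distr mv_normal_standard emeasure_density sets_PiM_I_finite)
    also have "\<dots> = (\<Prod>b\<in>(Basis::(real^'n) set). \<integral>\<^sup>+y. f b y \<partial>lborel)"
      by (rule nn_integral_lborel_prod) (simp_all add: f_def)
    also have "\<dots> = (\<Prod>i\<in>UNIV. emeasure ?N (A i))"
      by (simp add: Basis prod.reindex[OF inj] f_def emeasure_density)
    finally show "emeasure ?P (Pi\<^sub>E UNIV A) = (\<Prod>i\<in>UNIV. emeasure ?N (A i))" .
  qed simp_all
qed

lemma borel_measurable_vec_lambda:
  "(\<lambda>\<omega>. \<chi> i. \<omega> i) \<in> borel_measurable (Pi\<^sub>M UNIV (\<lambda>_. density lborel std_normal_density))"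
  unfolding borel_measurable_euclidean_space[where 'c="real^'n"]
  by (auto simp: Basis_vec_def inner_axis)

lemma distr_standard_normal_reindex:
  fixes e :: "'l::finite \<Rightarrow> 'm::finite"
  assumes e: "inj e"
  shows "distr (mv_normal 0 (mat 1 :: real^'m^'m)) borel (\<lambda>x. \<chi> i. x $ e i) = mv_normal 0 (mat 1)"
proof -
  let ?N = "density lborel std_normal_density"
  let ?L = "Pi\<^sub>M (UNIV :: 'l set) (\<lambda>_. ?N)" and ?M = "Pi\<^sub>M (UNIV :: 'm set) (\<lambda>_. ?N)"
  have vm: "($) \<in> mv_normal 0 (mat 1 :: real^'k^'k) \<rightarrow>\<^sub>M Pi\<^sub>M UNIV (\<lambda>_. ?N)"
    by (rule measurable_abs_UNIV) simp
  have em: "(\<lambda>\<omega> i. \<omega> (e i)) \<in> ?M \<rightarrow>\<^sub>M ?L"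
    by (intro measurable_abs_UNIV measurable_component_singleton) simp
  have "prob_space ?N" by (rule prob_space_normal_density) simp
  then have re: "distr ?M ?L (\<lambda>\<omega> i. \<omega> (e i)) = ?L"
    using distr_PiM_reindex[of UNIV "\<lambda>_. ?N" e UNIV] e by (simp add: restrict_def)
  have "distr (mv_normal 0 (mat 1 :: real^'m^'m)) borel (\<lambda>x. \<chi> i. x $ e i)
      = distr (distr (distr (mv_normal 0 (mat 1 :: real^'m^'m)) ?M ($)) ?L (\<lambda>\<omega> i. \<omega> (e i))) borel (\<lambda>\<omega>. \<chi> i. \<omega> i)"
    unfolding distr_distr[OF em vm] distr_distr[OF borel_measurable_vec_lambda measurable_comp[OF vm em]]
    by (simp add: o_def)
  also have "\<dots> = distr (distr (mv_normal 0 (mat 1 :: real^'l^'l)) ?L ($)) borel (\<lambda>\<omega>. \<chi> i. \<omega> i)"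
    by (simp add: standard_normal_coordinates re)
  also have "\<dots> = mv_normal 0 (mat 1 :: real^'l^'l)"
    unfolding distr_distr[OF borel_measurable_vec_lambda vm] by (simp add: o_def distr_id2)
  finally show ?thesis .
qed

text \<open>
  Up to a rotation, which preserves the standard normal law, \<open>U\<close> selects coordinates, and these are again
  independent standard normal variables.
\<close>

lemma distr_standard_normal_coisometry:
  fixes U :: "real^'m^'l"
  assumes "U ** transpose U = mat 1"
  shows "distr (mv_normal 0 (mat 1)) borel ((*v) U) = mv_normal 0 (mat 1)"
proof -
  obtain Q e where Q: "orthogonal_matrix Q" and e: "inj e" and Qe: "\<And>i. Q $ e i = U $ i"
    using coisometry_extend_orthogonal[OF assms] by blast
  have one: "Q ** diagonal_matrix 1 = Q"
    by (simp add: matrix_eq diagonal_matrix_vector flip: matrix_vector_mul_assoc)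
  have "distr (mv_normal 0 (mat 1)) borel ((*v) Q) = mv_normal 0 (mat 1)"
    using distr_standard_normal_scaled_rotation[OF Q, of 1] Q by (simp add: one orthogonal_matrix_def)
  then have "mv_normal 0 (mat 1)
      = distr (distr (mv_normal 0 (mat 1)) borel ((*v) Q)) borel (\<lambda>x. \<chi> i. x $ e i)"
    using e by (simp add: distr_standard_normal_reindex)
  also have "\<dots> = distr (mv_normal 0 (mat 1)) borel (\<lambda>x. \<chi> i. (Q *v x) $ e i)"
    by (subst distr_distr) (auto simp: o_def intro!: borel_measurable_continuous_onI continuous_intros)
  also have "(\<lambda>x. \<chi> i. (Q *v x) $ e i) = (*v) U"
    by (simp add: fun_eq_iff vec_eq_iff matrix_vector_mult_def Qe)
  finally show ?thesis ..
qed

text \<open>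
  With an invertible \<open>R\<close> such that \<open>A ** transpose A = R ** transpose R\<close>, the matrix \<open>U = R\<inverse> ** A\<close> is a
  coisometry. So \<open>A = R ** U\<close> maps the standard normal law of the larger space to that of the smaller
  one, and then to its image under \<open>R\<close>, which is known.
\<close>

lemma distr_standard_normal_linear:
  fixes A :: "real^'m^'l"
  assumes pd: "pos_def_matrix (A ** transpose A)"
  shows "distr (mv_normal 0 (mat 1)) borel ((*v) A) = mv_normal 0 (A ** transpose A)"
proof -
  obtain Q s where Q: "orthogonal_matrix Q" and s: "\<And>i. s $ i > 0"
    and eq: "A ** transpose A = (Q ** diagonal_matrix s) ** transpose (Q ** diagonal_matrix s)"
    using pos_def_matrix_factorization[OF pd] by blast
  define R where "R = Q ** diagonal_matrix s"
  have "det R \<noteq> 0"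
    using det_orthogonal_matrix[OF Q] s
    by (auto simp: R_def det_mul det_diagonal_matrix less_imp_neq[THEN not_sym])
  then obtain R' where R': "R ** R' = mat 1" "R' ** R = mat 1"
    by (auto simp: invertible_def simp flip: invertible_det_nz)
  define U where "U = R' ** A"
  have RU: "R ** U = A" by (simp add: U_def matrix_mul_assoc R')
  have "U ** transpose U = R' ** (A ** transpose A) ** transpose R'"
    by (simp add: U_def matrix_transpose_mul matrix_mul_assoc)
  also have "\<dots> = (R' ** R) ** transpose (R' ** R)"
    by (simp add: eq flip: R_def) (simp add: matrix_transpose_mul matrix_mul_assoc)
  finally have "U ** transpose U = mat 1" by (simp add: R')
  then have "distr (mv_normal 0 (mat 1)) borel ((*v) R)
      = distr (distr (mv_normal 0 (mat 1)) borel ((*v) U)) borel ((*v) R)"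
    by (simp add: distr_standard_normal_coisometry)
  also have "\<dots> = distr (mv_normal 0 (mat 1)) borel ((*v) A)"
    by (subst distr_distr) (simp_all add: o_def matrix_vector_mul_assoc RU)
  finally show ?thesis
    using distr_standard_normal_scaled_rotation[OF Q s] by (simp add: eq flip: R_def)
qed

text \<open>
  The law on the left is the image of the standard normal law under \<open>J ** A\<close>, where \<open>D = A ** transpose A\<close>.
  Full rank of \<open>J\<close> makes the new covariance positive definite.
\<close>

lemma distr_mv_normal_linear:
  fixes D :: "real^'m^'m" and J :: "real^'m^'l"
  assumes D: "pos_def_matrix D" and J: "rank J = CARD('l)"
  shows "distr (mv_normal 0 D) borel ((*v) J) = mv_normal 0 (J ** D ** transpose J)"
proof -
  obtain Q s where Q: "orthogonal_matrix Q" and s: "\<And>i. s $ i > 0"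
    and eq: "D = (Q ** diagonal_matrix s) ** transpose (Q ** diagonal_matrix s)"
    using pos_def_matrix_factorization[OF D] by blast
  define A where "A = Q ** diagonal_matrix s"
  have JA: "J ** D ** transpose J = (J ** A) ** transpose (J ** A)"
    by (simp add: eq flip: A_def) (simp add: matrix_transpose_mul matrix_mul_assoc)
  have "pos_def_matrix (J ** D ** transpose J)"
    unfolding pos_def_matrix_def
  proof (intro conjI allI impI)
    show "transpose (J ** D ** transpose J) = J ** D ** transpose J"
      by (simp add: JA) (simp add: matrix_transpose_mul)
    fix y :: "real^'l" assume "y \<noteq> 0"
    have "inj ((*v) (transpose J))"
      using J by (simp add: rank_transpose flip: full_rank_injective)
    then have "transpose J *v y \<noteq> 0" using \<open>y \<noteq> 0\<close> by (metis injD matrix_vector_mult_0_right)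
    then have "0 < (transpose J *v y) \<bullet> (D *v (transpose J *v y))"
      using D by (simp add: pos_def_matrix_def)
    also have "\<dots> = y \<bullet> ((J ** D ** transpose J) *v y)"
      by (metis dot_lmul_matrix matrix_vector_mul_assoc transpose_transpose vector_transpose_matrix)
    finally show "0 < y \<bullet> ((J ** D ** transpose J) *v y)" .
  qed
  then have "mv_normal 0 (J ** D ** transpose J) = distr (mv_normal 0 (mat 1)) borel ((*v) (J ** A))"
    by (simp add: JA distr_standard_normal_linear)
  also have "\<dots> = distr (distr (mv_normal 0 (mat 1)) borel ((*v) A)) borel ((*v) J)"
    by (subst distr_distr) (simp_all add: o_def matrix_vector_mul_assoc)
  also have "distr (mv_normal 0 (mat 1)) borel ((*v) A) = mv_normal 0 D"
    unfolding A_def by (simp add: distr_standard_normal_scaled_rotation[OF Q s] flip: eq)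
  finally show ?thesis ..
qed

lemma prob_space_mv_normal:
  fixes D :: "real^'m^'m"
  assumes D: "pos_def_matrix D"
  shows "prob_space (mv_normal 0 D)"
proof -
  obtain Q s where Q: "orthogonal_matrix Q" and s: "\<And>i. s $ i > 0"
    and eq: "D = (Q ** diagonal_matrix s) ** transpose (Q ** diagonal_matrix s)"
    using pos_def_matrix_factorization[OF D] by blast
  let ?P = "Pi\<^sub>M (UNIV :: 'm set) (\<lambda>_. density lborel std_normal_density)"
  have vm: "($) \<in> mv_normal 0 (mat 1 :: real^'m^'m) \<rightarrow>\<^sub>M ?P"
    by (rule measurable_abs_UNIV) simp
  have "prob_space ?P" by (intro prob_space_PiM prob_space_normal_density) simp
  then have "prob_space (mv_normal 0 (mat 1 :: real^'m^'m))"
    using prob_space_distrD[OF vm] by (simp add: standard_normal_coordinates)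
  then have "prob_space (distr (mv_normal 0 (mat 1)) borel ((*v) (Q ** diagonal_matrix s)))"
    by (rule prob_space.prob_space_distr) simp
  then show ?thesis
    using distr_standard_normal_scaled_rotation[OF Q s] eq by simp
qed

section \<open>Smooth maps close to a linear map\<close>

text \<open>
  The map \<open>x + h x\<close> shrinks distances by a factor close to 1 at worst, so the preimage of a set has at
  most \<open>exp \<eta>\<close> times its volume. As it moves points by no more than \<open>\<delta> * R\<close>, the normal density at a point and
  at its image differ by a factor at most \<open>exp \<eta>\<close> as well, by uniform continuity of its logarithm
  on a compact set. Only this inequality is asserted, not a matching lower bound: for laws of total mass
  close to 1 a one-sided estimate, applied to a set and to its complement, controls the distance.
\<close>

lemma mv_normal_near_identity:
  fixes D :: "real^'m^'m"
  assumes R: "R > 0" and e: "e > 0"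
  obtains \<delta> where "\<delta> > 0"
    "\<And>h A. \<lbrakk>h 0 = 0; A \<in> sets borel;
        \<And>x y. x \<in> ball 0 R \<Longrightarrow> y \<in> ball 0 R \<Longrightarrow> norm (h x - h y) \<le> \<delta> * norm (x - y)\<rbrakk>
      \<Longrightarrow> emeasure (mv_normal 0 D) {x \<in> ball 0 R. x + h x \<in> A} \<le> ennreal (1 + e) * emeasure (mv_normal 0 D) A"
proof -
  define q :: "real^'m \<Rightarrow> real" where "q = (\<lambda>x. x \<bullet> (matrix_inv D *v x) / 2)"
  define Z where "Z = sqrt ((2 * pi) ^ CARD('m) * det D)"
  define \<phi> where "\<phi> = (\<lambda>x. ennreal (exp (- q x) / Z))"
  have N: "mv_normal 0 D = density lborel \<phi>"
    by (simp add: mv_normal_def \<phi>_def q_def Z_def)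
  have q_cont: "continuous_on X q" for X
    unfolding q_def by (intro continuous_intros) auto
  then have [measurable]: "q \<in> borel_measurable borel" by (intro borel_measurable_continuous_onI)
  have \<phi>m [measurable]: "\<phi> \<in> borel_measurable borel" unfolding \<phi>_def by measurable
  \<comment> \<open>The error \<open>1 + e\<close> is shared equally between the volume and the density.\<close>
  define \<eta> where "\<eta> = ln (1 + e) / 2"
  have \<eta>: "\<eta> > 0" "exp \<eta> * exp \<eta> = 1 + e"
    using e by (simp_all add: \<eta>_def flip: exp_add)
  have "uniformly_continuous_on (cball 0 (R + 1)) q"
    using q_cont by (intro compact_uniformly_continuous) auto
  then obtain r where r: "r > 0"
    and rq: "\<And>x y. x \<in> cball 0 (R + 1) \<Longrightarrow> y \<in> cball 0 (R + 1) \<Longrightarrow> dist y x < r \<Longrightarrow> dist (q y) (q x) < \<eta>"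
    using \<eta>(1) unfolding uniformly_continuous_on_def by metis
  have "eventually (\<lambda>\<delta>::real. \<delta> > 0 \<and> \<delta> < 1 \<and> \<delta> * R < 1 \<and> \<delta> * R < r \<and> (1 / (1 - \<delta>)) ^ DIM(real^'m) < exp \<eta>) (at_right 0)"
  proof (intro eventually_conj)
    show "eventually (\<lambda>\<delta>::real. \<delta> > 0) (at_right 0)" by (rule eventually_at_right_less)
    show "eventually (\<lambda>\<delta>::real. \<delta> < 1) (at_right 0)"
      by (rule order_tendstoD[OF tendsto_ident_at]) simp
    have lim: "((\<lambda>\<delta>. \<delta> * R) \<longlongrightarrow> 0 * R) (at_right 0)" by (intro tendsto_intros)
    show "eventually (\<lambda>\<delta>. \<delta> * R < 1) (at_right 0)" "eventually (\<lambda>\<delta>. \<delta> * R < r) (at_right 0)"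
      using order_tendstoD(2)[OF lim] r by auto
    have "((\<lambda>\<delta>::real. (1 / (1 - \<delta>)) ^ DIM(real^'m)) \<longlongrightarrow> (1 / (1 - 0)) ^ DIM(real^'m)) (at_right 0)"
      by (intro tendsto_intros) auto
    then show "eventually (\<lambda>\<delta>::real. (1 / (1 - \<delta>)) ^ DIM(real^'m) < exp \<eta>) (at_right 0)"
      using \<eta>(1) by (intro order_tendstoD(2)[where a="exp \<eta>"]) auto
  qed
  then obtain \<delta> where \<delta>: "\<delta> > 0" "\<delta> < 1" "\<delta> * R < 1" "\<delta> * R < r"
      and vol: "(1 / (1 - \<delta>)) ^ DIM(real^'m) < exp \<eta>"
    using eventually_happens'[OF trivial_limit_at_right_real] by blast
  show thesis
  proof (rule that[OF \<delta>(1)])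
    fix h :: "real^'m \<Rightarrow> real^'m" and A :: "(real^'m) set"
    assume h0: "h 0 = 0" and A [measurable]: "A \<in> sets borel"
      and lip: "\<And>x y. x \<in> ball 0 R \<Longrightarrow> y \<in> ball 0 R \<Longrightarrow> norm (h x - h y) \<le> \<delta> * norm (x - y)"
    define H where "H = (\<lambda>x. x + h x)"
    let ?B = "ball 0 R :: (real^'m) set"
    have expand: "norm (x - y) \<le> 1 / (1 - \<delta>) * norm (H x - H y)" if "x \<in> ?B" "y \<in> ?B" for x y
    proof -
      have "norm (x - y) \<le> norm (H x - H y) + norm (h x - h y)"
        using norm_triangle_ineq4[of "H x - H y" "h x - h y"] by (simp add: H_def algebra_simps)
      then have "(1 - \<delta>) * norm (x - y) \<le> norm (H x - H y)"
        using lip[OF that] by (simp add: algebra_simps)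
      then show ?thesis using \<delta> by (simp add: field_simps)
    qed
    have "\<delta>-lipschitz_on ?B h"
      using lip \<delta>(1) by (intro lipschitz_onI) (auto simp: dist_norm)
    then have hc: "continuous_on ?B h" by (rule lipschitz_on_continuous_on)
    let ?L = "restrict_space lborel ?B"
    have Hm [measurable]: "H \<in> borel_measurable ?L"
    proof -
      have "H \<in> borel_measurable (restrict_space borel ?B)"
        unfolding H_def by (intro borel_measurable_continuous_on_restrict continuous_intros hc)
      then show ?thesis
        unfolding measurable_cong_sets[OF sets_restrict_space_cong[OF sets_lborel] refl] .
    qed
    have pre: "{x \<in> ?B. H x \<in> C} \<in> sets borel" if "C \<in> sets borel" for C
      using measurable_sets[OF Hm that]
      by (simp add: space_restrict_space sets_restrict_space_iff vimage_def Int_def conj_commute)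
    have dom: "distr ?L borel H \<le> density lborel (\<lambda>_. ennreal (exp \<eta>))"
    proof (subst le_measure, simp, intro ballI)
      fix C assume "C \<in> sets (distr ?L borel H)"
      then have C [measurable]: "C \<in> sets borel" by simp
      have "emeasure (distr ?L borel H) C = emeasure lborel {x \<in> ?B. H x \<in> C}"
      proof -
        have "H -` C \<inter> space ?L = {x \<in> ?B. H x \<in> C}" by (auto simp: space_restrict_space)
        then have "emeasure (distr ?L borel H) C = emeasure ?L {x \<in> ?B. H x \<in> C}"
          using C by (simp only: emeasure_distr[OF Hm])
        also have "\<dots> = emeasure lborel {x \<in> ?B. H x \<in> C}"
          by (rule emeasure_restrict_space) auto
        finally show ?thesis .
      qed
      also have "\<dots> \<le> ennreal ((1 / (1 - \<delta>)) ^ DIM(real^'m)) * emeasure lborel C"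
        using \<delta> expand pre[OF C] C
        by (intro emeasure_lborel_le_expanding_image[where H=H]) auto
      also have "\<dots> \<le> ennreal (exp \<eta>) * emeasure lborel C"
        using vol by (intro mult_right_mono ennreal_leI) auto
      finally show "emeasure (distr ?L borel H) C \<le> emeasure (density lborel (\<lambda>_. ennreal (exp \<eta>))) C"
        by (simp add: emeasure_density_const)
    qed
    have ratio: "\<phi> x \<le> ennreal (exp \<eta>) * \<phi> (H x)" if x: "x \<in> ?B" for x
    proof -
      have "norm (h x) \<le> \<delta> * norm x"
        using lip[OF x, of 0] R h0 by simp
      also have "\<dots> \<le> \<delta> * R" using x \<delta> by simp
      finally have hx: "norm (h x) \<le> \<delta> * R" .
      have dHx: "dist (H x) x = norm (h x)" by (simp add: H_def dist_norm)
      have "norm (H x) \<le> R + 1"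
        using norm_triangle_ineq[of x "h x"] hx \<delta>(3) x by (simp add: H_def)
      then have "dist (q (H x)) (q x) < \<eta>"
        using x dHx hx \<delta> by (intro rq) auto
      then have "- q x \<le> \<eta> - q (H x)" by (simp add: dist_real_def)
      then have "exp (- q x) \<le> exp \<eta> * exp (- q (H x))" by (simp flip: exp_add)
      show ?thesis
      \<comment> \<open>For negative \<open>Z\<close>, which occurs only if \<open>D\<close> is not positive definite, \<open>\<phi>\<close> is zero.\<close>
      proof (cases "Z \<ge> 0")
        case True
        have "exp (- q x) / Z \<le> exp \<eta> * (exp (- q (H x)) / Z)"
          using divide_right_mono[OF \<open>exp (- q x) \<le> exp \<eta> * exp (- q (H x))\<close> True] by simp
        then show ?thesis
          by (simp add: \<phi>_def ennreal_leI flip: ennreal_mult')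
      next
        case False
        then have "exp (- q x) / Z \<le> 0" by (simp add: divide_nonneg_neg less_imp_le divide_nonneg_nonpos)
        then show ?thesis by (simp add: \<phi>_def ennreal_neg)
      qed
    qed
    have "emeasure (mv_normal 0 D) {x \<in> ?B. x + h x \<in> A} = (\<integral>\<^sup>+x. \<phi> x * indicator {x \<in> ?B. H x \<in> A} x \<partial>lborel)"
      using pre[OF A] by (simp add: N emeasure_density H_def)
    also have "\<dots> \<le> (\<integral>\<^sup>+x. ennreal (exp \<eta>) * (\<phi> (H x) * indicator A (H x)) * indicator ?B x \<partial>lborel)"
      using ratio by (intro nn_integral_mono) (auto simp: indicator_def)
    also have "\<dots> = (\<integral>\<^sup>+x. ennreal (exp \<eta>) * (\<phi> (H x) * indicator A (H x)) \<partial>?L)"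
      by (subst nn_integral_restrict_space) auto
    also have "\<dots> = (\<integral>\<^sup>+y. ennreal (exp \<eta>) * (\<phi> y * indicator A y) \<partial>distr ?L borel H)"
      by (subst nn_integral_distr) auto
    also have "\<dots> \<le> (\<integral>\<^sup>+y. ennreal (exp \<eta>) * (\<phi> y * indicator A y) \<partial>density lborel (\<lambda>_. ennreal (exp \<eta>)))"
      using dom by (intro nn_integral_mono_measure) simp_all
    also have "\<dots> = ennreal (exp \<eta>) * (ennreal (exp \<eta>) * emeasure (mv_normal 0 D) A)"
      by (simp add: nn_integral_density nn_integral_cmult N emeasure_density)
    also have "\<dots> = ennreal (1 + e) * emeasure (mv_normal 0 D) A"
      by (simp only: \<eta>(2)[symmetric] ennreal_mult[OF exp_ge_zero exp_ge_zero] mult.assoc)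
    finally show "emeasure (mv_normal 0 D) {x \<in> ?B. x + h x \<in> A} \<le> ennreal (1 + e) * emeasure (mv_normal 0 D) A" .
  qed
qed

lemma norm_matrix_vector_le:
  fixes A :: "real^'m^'l"
  shows "norm (A *v x) \<le> norm A * norm x"
proof -
  have "norm (A *v x) \<le> L2_set (\<lambda>i. norm (A $ i) * norm x) UNIV"
    unfolding norm_vec_def[of "A *v x"]
    by (intro L2_set_mono) (auto simp: matrix_vector_mul_component Cauchy_Schwarz_ineq2)
  also have "\<dots> = norm A * norm x"
    by (simp add: norm_vec_def[of A] L2_set_left_distrib)
  finally show ?thesis .
qed

text \<open>
  The comparison of \<open>F\<close> with \<open>J\<close> between spaces of different dimension reduces to a perturbation of the
  identity of the larger space. If \<open>J'\<close> is a right inverse of \<open>J\<close> and \<open>h x = J' *v (F x - J *v x)\<close>, then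
  \<open>F x = J *v (x + h x)\<close>, and \<open>h\<close> has small derivative where that of \<open>F\<close> is close to \<open>J\<close>. Therefore \<open>F\<close> applied to
  the normal law is \<open>J\<close> applied to almost the same law.
\<close>

lemma mv_normal_near_linear:
  fixes D :: "real^'m^'m" and J :: "real^'m^'l"
  assumes D: "pos_def_matrix D" and J: "rank J = CARD('l)" and R: "R > 0" and e: "e > 0"
  obtains \<delta> where "\<delta> > 0"
    "\<And>F G B. \<lbrakk>F 0 = 0; B \<in> sets borel;
        \<And>x. x \<in> ball 0 R \<Longrightarrow> (F has_derivative (\<lambda>k. G x *v k)) (at x);
        \<And>x. x \<in> ball 0 R \<Longrightarrow> dist (G x) J \<le> \<delta>\<rbrakk>
      \<Longrightarrow> measure (mv_normal 0 D) {x \<in> ball 0 R. F x \<in> B}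
            \<le> measure (mv_normal 0 (J ** D ** transpose J)) B + e"
proof -
  let ?N = "mv_normal 0 D"
  interpret N: prob_space ?N by (rule prob_space_mv_normal[OF D])
  have "surj ((*v) J)" using J by (simp flip: full_rank_surjective)
  then obtain J' :: "real^'l^'m" where J': "J ** J' = mat 1"
    using matrix_right_invertible_surjective by blast
  obtain \<kappa> where \<kappa>: "\<kappa> > 0" and near: "\<And>h A. \<lbrakk>h 0 = 0; A \<in> sets borel;
        \<And>x y. x \<in> ball 0 R \<Longrightarrow> y \<in> ball 0 R \<Longrightarrow> norm (h x - h y) \<le> \<kappa> * norm (x - y)\<rbrakk>
      \<Longrightarrow> emeasure ?N {x \<in> ball 0 R. x + h x \<in> A} \<le> ennreal (1 + e) * emeasure ?N A"
    using mv_normal_near_identity[OF R e, of D] by blast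
  define \<delta> where "\<delta> = \<kappa> / (norm J' + 1)"
  have nJ: "norm J' + 1 > 0" by (simp add: add_nonneg_pos)
  have \<delta>: "\<delta> > 0" "norm J' * \<delta> \<le> \<kappa>"
    using \<kappa> nJ by (simp_all add: \<delta>_def field_simps)
  show thesis
  proof (rule that[OF \<delta>(1)])
    fix F :: "real^'m \<Rightarrow> real^'l" and G :: "real^'m \<Rightarrow> real^'m^'l" and B :: "(real^'l) set"
    assume F0: "F 0 = 0" and B [measurable]: "B \<in> sets borel"
      and der: "\<And>x. x \<in> ball 0 R \<Longrightarrow> (F has_derivative (\<lambda>k. G x *v k)) (at x)"
      and close: "\<And>x. x \<in> ball 0 R \<Longrightarrow> dist (G x) J \<le> \<delta>"
    define h where "h = (\<lambda>x. J' *v (F x - J *v x))"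
    have JH: "J *v (x + h x) = F x" for x
      by (simp add: h_def matrix_vector_right_distrib matrix_vector_mul_assoc J')
    have dh: "(h has_derivative (\<lambda>k. J' *v (G x *v k - J *v k))) (at x within ball 0 R)" if "x \<in> ball 0 R" for x
      unfolding h_def
      by (intro bounded_linear.has_derivative[OF matrix_vector_mul_bounded_linear] has_derivative_diff
          has_derivative_at_withinI[OF der[OF that]]
          bounded_linear_imp_has_derivative matrix_vector_mul_bounded_linear)
    have on: "onorm (\<lambda>k. J' *v (G x *v k - J *v k)) \<le> \<kappa>" if "x \<in> ball 0 R" for x
    proof (rule onorm_le)
      fix k
      have "norm (J' *v (G x *v k - J *v k)) \<le> norm J' * norm ((G x - J) *v k)"
        by (simp add: norm_matrix_vector_le matrix_vector_mult_diff_rdistrib)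
      also have "\<dots> \<le> norm J' * (\<delta> * norm k)"
        using mult_right_mono[OF close[OF that], of "norm k"] norm_matrix_vector_le[of "G x - J" k]
        by (intro mult_left_mono) (auto simp: dist_norm)
      also have "\<dots> \<le> \<kappa> * norm k"
        using mult_right_mono[OF \<delta>(2), of "norm k"] by (simp add: mult.assoc)
      finally show "norm (J' *v (G x *v k - J *v k)) \<le> \<kappa> * norm k" .
    qed
    let ?A = "(*v) J -` B"
    have A: "?A \<in> sets borel" using measurable_sets[OF borel_measurable_matrix_vector B] by simp
    have lip: "norm (h x - h y) \<le> \<kappa> * norm (x - y)" if "x \<in> ball 0 R" "y \<in> ball 0 R" for x y
      using differentiable_bound[OF convex_ball dh on that(1) that(2)] by simp
    have "emeasure ?N {x \<in> ball 0 R. x + h x \<in> ?A} \<le> ennreal (1 + e) * emeasure ?N ?A"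
      using lip by (intro near A) (simp_all add: h_def F0)
    then have "measure ?N {x \<in> ball 0 R. F x \<in> B} \<le> (1 + e) * measure ?N ?A"
      using e by (simp add: JH N.emeasure_eq_measure flip: ennreal_mult' del: ennreal_plus)
    also have "\<dots> \<le> measure ?N ?A + e"
      using e N.prob_le_1[of ?A] by (simp add: algebra_simps mult_left_le)
    also have "measure ?N ?A = measure (mv_normal 0 (J ** D ** transpose J)) B"
      by (simp add: distr_mv_normal_linear[OF D J, symmetric] measure_distr)
    finally show "measure ?N {x \<in> ball 0 R. F x \<in> B}
        \<le> measure (mv_normal 0 (J ** D ** transpose J)) B + e" .
  qed
qed

section \<open>From localised parameters to their images\<close>

text \<open>
  If the law of \<open>X\<close> is close to \<open>N\<close>, then that of \<open>Y\<close>, which equals \<open>F (X \<eta>)\<close> as long as \<open>X \<eta>\<close> lies in \<open>K\<close>, exceeds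
  \<open>N'\<close> by little on every set: compare on \<open>K\<close> by means of the one-sided bound for \<open>F\<close>, and bound the mass
  outside \<open>K\<close> by that of \<open>N\<close>. The reverse inequality follows by passing to the complement of \<open>B\<close>, at the
  price of one more \<open>a\<close> because the total mass of \<open>P\<close> on \<open>\<Theta>\<close> is known only up to \<open>a\<close>.
\<close>

lemma transfer_of_laws:
  fixes X :: "'p \<Rightarrow> 'b::topological_space" and Y :: "'p \<Rightarrow> 'c::topological_space"
  assumes P: "finite_measure P"
    and N: "prob_space N" "sets N = sets borel" and N': "prob_space N'" "sets N' = sets borel"
    and X: "\<And>B. B \<in> sets borel \<Longrightarrow> {\<eta>\<in>\<Theta>. X \<eta> \<in> B} \<in> sets P"
    and Y: "\<And>B. B \<in> sets borel \<Longrightarrow> {\<eta>\<in>\<Theta>. Y \<eta> \<in> B} \<in> sets P"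
    and K: "K \<in> sets borel" "measure N K \<ge> 1 - b"
    and F: "\<And>B. B \<in> sets borel \<Longrightarrow> {x\<in>K. F x \<in> B} \<in> sets borel"
    and YF: "\<And>\<eta>. \<eta> \<in> \<Theta> \<Longrightarrow> X \<eta> \<in> K \<Longrightarrow> Y \<eta> = F (X \<eta>)"
    and XN: "\<And>B. B \<in> sets borel \<Longrightarrow> \<bar>measure P {\<eta>\<in>\<Theta>. X \<eta> \<in> B} - measure N B\<bar> \<le> a"
    and FN: "\<And>B. B \<in> sets borel \<Longrightarrow> measure N {x\<in>K. F x \<in> B} \<le> measure N' B + c"
    and B: "B \<in> sets borel"
  shows "\<bar>measure P {\<eta>\<in>\<Theta>. Y \<eta> \<in> B} - measure N' B\<bar> \<le> 3 * a + b + c"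
proof -
  interpret P: finite_measure P by fact
  interpret N: prob_space N by fact
  interpret N': prob_space N' by fact
  have spN: "space N = UNIV" "space N' = UNIV"
    using N(2) N'(2) sets_eq_imp_space_eq by (metis space_borel)+
  have upper: "measure P {\<eta>\<in>\<Theta>. Y \<eta> \<in> B} \<le> measure N' B + 2 * a + b + c" if B: "B \<in> sets borel" for B
  proof -
    let ?S = "{x\<in>K. F x \<in> B}"
    have "measure P {\<eta>\<in>\<Theta>. Y \<eta> \<in> B} \<le> measure P ({\<eta>\<in>\<Theta>. X \<eta> \<in> ?S} \<union> {\<eta>\<in>\<Theta>. X \<eta> \<in> - K})"
      using YF F[OF B] X K(1) by (intro P.finite_measure_mono sets.Un X borel_comp) auto
    also have "\<dots> \<le> measure P {\<eta>\<in>\<Theta>. X \<eta> \<in> ?S} + measure P {\<eta>\<in>\<Theta>. X \<eta> \<in> - K}"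
      using F[OF B] X K(1) by (intro measure_Un_le X borel_comp)
    also have "\<dots> \<le> (measure N ?S + a) + (measure N (- K) + a)"
      using XN[OF F[OF B]] XN[of "- K"] K(1) by (intro add_mono) (auto simp: borel_comp)
    also have "measure N (- K) \<le> b"
      using N.prob_compl[of K] K N(2) by (simp add: spN Compl_eq_Diff_UNIV)
    finally show ?thesis using FN[OF B] by simp
  qed
  have "measure P ({\<eta>\<in>\<Theta>. Y \<eta> \<in> B} \<union> {\<eta>\<in>\<Theta>. Y \<eta> \<in> - B})
      = measure P {\<eta>\<in>\<Theta>. Y \<eta> \<in> B} + measure P {\<eta>\<in>\<Theta>. Y \<eta> \<in> - B}"
    using B by (intro P.finite_measure_Union Y borel_comp) auto
  moreover have "{\<eta>\<in>\<Theta>. Y \<eta> \<in> B} \<union> {\<eta>\<in>\<Theta>. Y \<eta> \<in> - B} = {\<eta>\<in>\<Theta>. X \<eta> \<in> UNIV}"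
    by auto
  moreover have "measure P {\<eta>\<in>\<Theta>. X \<eta> \<in> UNIV} \<ge> 1 - a"
    using XN[of UNIV] N.prob_space spN by (auto simp: abs_le_iff)
  moreover have "measure N' (- B) = 1 - measure N' B"
    using N'.prob_compl[of B] B N'(2) by (simp add: spN Compl_eq_Diff_UNIV)
  moreover have "a \<ge> 0" using XN[of UNIV] by (smt (verit) sets.top space_borel)
  ultimately show ?thesis
    using upper[OF B] upper[of "- B"] B by (simp add: borel_comp abs_le_iff)
qed

text \<open>
  Finiteness matters twice: \<open>measure\<close> of a set of infinite mass is 0 by convention, and a real-valued
  supremum is meaningful only over a bounded family.
\<close>

lemma emeasure_posterior_le_1:
  assumes [measurable]: "(\<lambda>\<eta>. ennreal (L \<eta> * q \<eta>) * indicator \<Theta> \<eta>) \<in> borel_measurable borel"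
  shows "emeasure (posterior \<Theta> L q) UNIV \<le> 1"
proof -
  let ?Z = "\<integral>\<^sup>+\<eta>\<in>\<Theta>. ennreal (L \<eta> * q \<eta>) \<partial>lborel"
  have "emeasure (posterior \<Theta> L q) UNIV = (\<integral>\<^sup>+\<eta>. ennreal (L \<eta> * q \<eta>) * indicator \<Theta> \<eta> / ?Z \<partial>lborel)"
    by (simp add: posterior_def emeasure_density)
  also have "\<dots> = ?Z / ?Z" by (rule nn_integral_divide) simp
  also have "\<dots> \<le> 1"
    by (cases "?Z = 0 \<or> ?Z = \<top>") (auto simp: ennreal_divide_self less_top)
  finally show ?thesis .
qed

lemma sets_posterior [simp]: "sets (posterior \<Theta> L q) = sets borel"
  by (simp add: posterior_def)

lemma posterior_density_measurable:
  assumes model: "dominated_model \<Theta> \<nu> p" and prior: "prior_density \<Theta> \<nu> q"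
    and \<Theta>: "\<Theta> \<in> sets borel" and x: "x \<in> space \<nu>"
  shows "(\<lambda>\<eta>. ennreal (p \<eta> x * q \<eta> x) * indicator \<Theta> \<eta>) \<in> borel_measurable borel"
proof -
  have "(\<lambda>\<eta>. p \<eta> x) \<in> borel_measurable (restrict_space borel \<Theta>)"
    using measurable_compose[OF measurable_Pair2'[OF x], of "\<lambda>(\<theta>, x). p \<theta> x"] model
    by (simp add: dominated_model_def)
  moreover have "(\<lambda>\<eta>. q \<eta> x) \<in> borel_measurable (restrict_space borel \<Theta>)"
    using measurable_compose[OF measurable_Pair2'[OF x], of "\<lambda>(\<theta>, x). q \<theta> x"] prior
    by (simp add: prior_density_def)
  ultimately have "(\<lambda>\<eta>. ennreal (p \<eta> x * q \<eta> x)) \<in> borel_measurable (restrict_space borel \<Theta>)"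
    by simp
  then show ?thesis using \<Theta> by (simp add: borel_measurable_restrict_space_iff_ennreal)
qed

lemma localize_rescale:
  assumes "\<And>i. v $ i > 0"
  shows "localize v \<theta> (v * (\<eta> - \<theta>)) = \<eta>"
  using assms by (simp add: localize_def vec_eq_iff less_imp_neq[THEN not_sym] flip: mult.assoc)

text \<open>
  The derivative of \<open>T\<close> is given within \<open>\<Theta>\<close> only, and \<open>\<Theta>\<close> may have no interior near the point in question
  a priori. But if \<open>\<Theta>\<close> contains the image of an open set under localisation, the composite is
  differentiable in the usual sense, so that \<open>jacobian\<close> is its derivative and not an arbitrary value.
\<close>

lemma has_derivative_rescaled_map:
  assumes T: "continuously_differentiable_on T \<Theta>"
    and U: "open U" "\<Delta> \<in> U" "\<And>\<Delta>. \<Delta> \<in> U \<Longrightarrow> localize v \<theta> \<Delta> \<in> \<Theta>"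
  shows "(rescaled_map w v T \<theta> has_derivative (\<lambda>k. jacobian (rescaled_map w v T \<theta>) (at \<Delta>) *v k)) (at \<Delta>)"
proof -
  obtain T' where T': "\<And>\<eta>. \<eta> \<in> \<Theta> \<Longrightarrow> (T has_derivative (\<lambda>h. T' \<eta> *v h)) (at \<eta> within \<Theta>)"
    using T by (auto simp: continuously_differentiable_on_def)
  let ?L = "diagonal_matrix (\<chi> i. inverse (v $ i))"
  have loc: "localize v \<theta> = (\<lambda>\<Delta>. \<theta> + ?L *v \<Delta>)"
    by (simp add: localize_def diagonal_matrix_vector fun_eq_iff)
  have "(localize v \<theta> has_derivative (\<lambda>k. ?L *v k)) (at \<Delta> within U)"
    unfolding loc
    by (auto intro!: derivative_eq_intros bounded_linear_imp_has_derivative matrix_vector_mul_bounded_linear)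
  moreover have "(T has_derivative (\<lambda>h. T' (localize v \<theta> \<Delta>) *v h)) (at (localize v \<theta> \<Delta>) within localize v \<theta> ` U)"
    using U by (intro has_derivative_subset[OF T']) auto
  ultimately have "((\<lambda>\<Delta>. T (localize v \<theta> \<Delta>)) has_derivative (\<lambda>k. T' (localize v \<theta> \<Delta>) *v (?L *v k))) (at \<Delta> within U)"
    by (rule has_derivative_in_compose)
  then have TL: "((\<lambda>\<Delta>. T (localize v \<theta> \<Delta>)) has_derivative (\<lambda>k. T' (localize v \<theta> \<Delta>) *v (?L *v k))) (at \<Delta>)"
    by (simp only: at_within_open[OF U(2,1)])
  have "((\<lambda>\<Delta>. diagonal_matrix w *v (T (localize v \<theta> \<Delta>) - T \<theta>)) has_derivative
      (\<lambda>k. diagonal_matrix w *v (T' (localize v \<theta> \<Delta>) *v (?L *v k) - 0))) (at \<Delta>)"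
    by (intro bounded_linear.has_derivative[OF matrix_vector_mul_bounded_linear] has_derivative_diff TL
        has_derivative_const)
  then have "rescaled_map w v T \<theta> differentiable (at \<Delta>)"
    unfolding differentiable_def rescaled_map_def[abs_def] diagonal_matrix_vector by blast
  then show ?thesis by (simp flip: jacobian_works)
qed

lemma continuously_differentiable_imp_continuous_on:
  "continuously_differentiable_on T \<Theta> \<Longrightarrow> continuous_on \<Theta> T"
  by (auto simp: continuously_differentiable_on_def intro: has_derivative_continuous_on)

lemma sets_borel_vimage_continuous_on:
  assumes "continuous_on S f" "S \<in> sets borel" "B \<in> sets borel"
  shows "{x \<in> S. f x \<in> B} \<in> sets borel"
  using measurable_sets[OF borel_measurable_continuous_on_restrict[OF assms(1)] assms(3)] assms(2)
  by (simp add: space_restrict_space sets_restrict_space_iff vimage_def Int_def conj_commute)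

lemma continuous_on_vec_times:
  fixes f :: "'b::topological_space \<Rightarrow> real^'n"
  shows "continuous_on S f \<Longrightarrow> continuous_on S (\<lambda>x. w * f x)"
  unfolding times_vec_def by (intro continuous_intros)

text \<open>
  The deterministic core, uniform over all posteriors and maps: \<open>R\<close> and \<open>\<delta>\<close> depend only on the normal
  law, on \<open>J\<close> and on \<open>e\<close>. Because of this uniformity the theorem follows for random data
  by discarding the events on which one of the assumptions fails. The radius \<open>R\<close> is such that
  the normal law has little mass outside the ball.
\<close>

lemma delta_method_total_variation:
  fixes D :: "real^'m^'m" and J :: "real^'m^'l"
  assumes D: "pos_def_matrix D" and J: "rank J = CARD('l)" and e: "e > 0"
  obtains R \<delta> where "\<delta> > 0"
    "\<And>P \<Theta> v \<theta> w T B. \<lbrakk>sets P = sets borel; emeasure P UNIV \<le> 1; \<Theta> \<in> sets borel; \<And>i. v $ i > 0;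
        continuously_differentiable_on T \<Theta>;
        \<And>\<Delta>. \<Delta> \<in> cball 0 R \<Longrightarrow> localize v \<theta> \<Delta> \<in> \<Theta>;
        \<And>\<Delta>. \<Delta> \<in> cball 0 R \<Longrightarrow> dist (jacobian (rescaled_map w v T \<theta>) (at \<Delta>)) J \<le> \<delta>;
        \<And>A. A \<in> sets borel \<Longrightarrow> \<bar>measure P {\<eta>\<in>\<Theta>. v * (\<eta> - \<theta>) \<in> A} - measure (mv_normal 0 D) A\<bar> \<le> \<delta>;
        B \<in> sets borel\<rbrakk>
      \<Longrightarrow> \<bar>measure P {\<eta>\<in>\<Theta>. w * (T \<eta> - T \<theta>) \<in> B}
            - measure (mv_normal 0 (J ** D ** transpose J)) B\<bar> \<le> e"
proof -
  let ?N = "mv_normal 0 D" and ?N' = "mv_normal 0 (J ** D ** transpose J)"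
  interpret N: prob_space ?N by (rule prob_space_mv_normal[OF D])
  have N': "prob_space ?N'"
    unfolding distr_mv_normal_linear[OF D J, symmetric] by (rule N.prob_space_distr) simp
  have "(\<lambda>n. measure ?N (ball 0 (real n))) \<longlonglongrightarrow> measure ?N (\<Union>n. ball 0 (real n))"
    by (intro N.finite_Lim_measure_incseq) (auto simp: incseq_def)
  moreover have "(\<Union>n. ball 0 (real n)) = (UNIV :: (real^'m) set)"
    using reals_Archimedean2 by auto
  ultimately have "(\<lambda>n. measure ?N (ball 0 (real n))) \<longlonglongrightarrow> 1"
    using N.prob_space by simp
  then have "\<forall>\<^sub>F n in sequentially. measure ?N (ball 0 (real n)) > 1 - e / 5"
    using e by (intro order_tendstoD) auto
  then have "\<forall>\<^sub>F n in sequentially. measure ?N (ball 0 (real n)) > 1 - e / 5 \<and> n > 0"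
    using eventually_gt_at_top[of 0] by (rule eventually_conj)
  then obtain n where n: "measure ?N (ball 0 (real n)) > 1 - e / 5" "n > 0"
    using eventually_happens' sequentially_bot by blast
  define R where "R = real n"
  have R: "R > 0" and mR: "measure ?N (ball 0 R) \<ge> 1 - e / 5" using n by (simp_all add: R_def)
  obtain \<kappa> where \<kappa>: "\<kappa> > 0" and near: "\<And>F G B. \<lbrakk>F 0 = 0; B \<in> sets borel;
        \<And>x. x \<in> ball 0 R \<Longrightarrow> (F has_derivative (\<lambda>k. G x *v k)) (at x);
        \<And>x. x \<in> ball 0 R \<Longrightarrow> dist (G x) J \<le> \<kappa>\<rbrakk>
      \<Longrightarrow> measure ?N {x \<in> ball 0 R. F x \<in> B} \<le> measure ?N' B + e / 5"
    using mv_normal_near_linear[OF D J R, of "e / 5"] e by auto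
  define \<delta> where "\<delta> = min \<kappa> (e / 5)"
  show thesis
  proof (rule that)
    show "\<delta> > 0" using \<kappa> e by (simp add: \<delta>_def)
    fix P :: "(real^'m) measure" and \<Theta> :: "(real^'m) set" and v \<theta> :: "real^'m"
      and w :: "real^'l" and T :: "real^'m \<Rightarrow> real^'l" and B :: "(real^'l) set"
    assume P: "sets P = sets borel" "emeasure P UNIV \<le> 1" and \<Theta>: "\<Theta> \<in> sets borel"
      and v: "\<And>i. v $ i > 0" and T: "continuously_differentiable_on T \<Theta>"
      and loc: "\<And>\<Delta>. \<Delta> \<in> cball 0 R \<Longrightarrow> localize v \<theta> \<Delta> \<in> \<Theta>"
      and jac: "\<And>\<Delta>. \<Delta> \<in> cball 0 R \<Longrightarrow> dist (jacobian (rescaled_map w v T \<theta>) (at \<Delta>)) J \<le> \<delta>"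
      and close: "\<And>A. A \<in> sets borel \<Longrightarrow> \<bar>measure P {\<eta>\<in>\<Theta>. v * (\<eta> - \<theta>) \<in> A} - measure ?N A\<bar> \<le> \<delta>"
      and B: "B \<in> sets borel"
    let ?F = "rescaled_map w v T \<theta>"
    have spP: "space P = UNIV" using P(1) sets_eq_imp_space_eq by (metis space_borel)
    have fin: "finite_measure P" using P(2) by (intro finite_measureI) (auto simp: spP top_unique)
    have der: "(?F has_derivative (\<lambda>k. jacobian ?F (at x) *v k)) (at x)" if "x \<in> ball 0 R" for x
      using loc by (intro has_derivative_rescaled_map[OF T open_ball that]) auto
    then have contF: "continuous_on (ball 0 R) ?F"
      by (rule has_derivative_continuous_on[OF has_derivative_at_withinI])
    \<comment> \<open>Three errors from the law of the localised parameter, one from the tail of the normal law, one from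
      the deviation of the derivative from \<open>J\<close>.\<close>
    have "\<bar>measure P {\<eta>\<in>\<Theta>. w * (T \<eta> - T \<theta>) \<in> B} - measure ?N' B\<bar> \<le> 3 * (e / 5) + e / 5 + e / 5"
    proof (rule transfer_of_laws[where X="\<lambda>\<eta>. v * (\<eta> - \<theta>)" and F="?F" and K="ball 0 R" and N="?N"])
      fix A :: "(real^'m) set" assume A: "A \<in> sets borel"
      have "continuous_on \<Theta> (\<lambda>\<eta>. v * (\<eta> - \<theta>))" by (intro continuous_on_vec_times continuous_intros)
      then show "{\<eta>\<in>\<Theta>. v * (\<eta> - \<theta>) \<in> A} \<in> sets P"
        using sets_borel_vimage_continuous_on[OF _ \<Theta> A] by (simp add: P(1))
      show "\<bar>measure P {\<eta>\<in>\<Theta>. v * (\<eta> - \<theta>) \<in> A} - measure ?N A\<bar> \<le> e / 5"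
        using close[OF A] by (simp add: \<delta>_def)
    next
      fix A :: "(real^'l) set" assume A: "A \<in> sets borel"
      have "continuous_on \<Theta> (\<lambda>\<eta>. w * (T \<eta> - T \<theta>))"
        by (intro continuous_on_vec_times continuous_intros continuously_differentiable_imp_continuous_on[OF T])
      then show "{\<eta>\<in>\<Theta>. w * (T \<eta> - T \<theta>) \<in> A} \<in> sets P"
        using sets_borel_vimage_continuous_on[OF _ \<Theta> A] by (simp add: P(1))
      show "{x \<in> ball 0 R. ?F x \<in> A} \<in> sets borel"
        by (rule sets_borel_vimage_continuous_on[OF contF _ A]) simp
      show "measure ?N {x \<in> ball 0 R. ?F x \<in> A} \<le> measure ?N' A + e / 5"
      proof (rule near[OF _ A der])
        have "localize v \<theta> 0 = \<theta>" by (simp add: localize_def)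
        then show "?F 0 = 0" by (simp add: rescaled_map_def)
      qed (use jac in \<open>auto simp: \<delta>_def\<close>)
    next
      fix \<eta> assume "\<eta> \<in> \<Theta>"
      show "w * (T \<eta> - T \<theta>) = ?F (v * (\<eta> - \<theta>))"
        by (simp add: rescaled_map_def localize_rescale v)
    qed (use fin N' mR B in \<open>auto simp: spP intro: N.prob_space_axioms\<close>)
    then show "\<bar>measure P {\<eta>\<in>\<Theta>. w * (T \<eta> - T \<theta>) \<in> B} - measure ?N' B\<bar> \<le> e" by simp
  qed
qed
section \<open>The delta method for posterior distributions\<close>

theorem theorem2p9:
  fixes M \<nu> :: "nat \<Rightarrow> 'a measure"
    and \<Theta> :: "(real^'m) set"
    and p q :: "nat \<Rightarrow> real^'m \<Rightarrow> 'a \<Rightarrow> real"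
    and Post :: "nat \<Rightarrow> 'a \<Rightarrow> (real^'m) measure"
    and v :: "nat \<Rightarrow> real^'m" and \<theta> :: "nat \<Rightarrow> 'a \<Rightarrow> real^'m" and \<theta>\<^sub>0 :: "real^'m"
    and D :: "real^'m^'m"
    and T :: "nat \<Rightarrow> real^'m \<Rightarrow> real^'l" and w :: "nat \<Rightarrow> real^'l" and J :: "real^'m^'l"
  assumes data: "\<And>n. prob_space (M n)" "\<And>n. sets (\<nu> n) = sets (M n)"
    and param: "\<Theta> \<in> sets borel"
    and model: "\<And>n. dominated_model \<Theta> (\<nu> n) (p n)"
    and prior: "\<And>n. prior_density \<Theta> (\<nu> n) (q n)"
    and post: "\<And>n x. Post n x = posterior \<Theta> (\<lambda>\<eta>. p n \<eta> x) (\<lambda>\<eta>. q n \<eta> x)"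
    and v_pos: "\<And>n i. v n $ i > 0"
    and v_lim: "\<And>i. filterlim (\<lambda>n. v n $ i) at_top sequentially"
    and \<theta>_rv: "\<And>n. \<theta> n \<in> borel_measurable (M n)"
    and \<theta>_lim: "tendsto_in_prob M \<theta> \<theta>\<^sub>0"
    and D_pd: "pos_def_matrix D"
    and BvM: "tendsto_in_prob M
        (\<lambda>n x. SUP B\<in>sets (borel :: (real^'m) measure).
           \<bar>measure (Post n x) {\<eta>\<in>\<Theta>. v n * (\<eta> - \<theta> n x) \<in> B} - measure (mv_normal 0 D) B\<bar>) 0"
    and dims: "CARD('l) \<le> CARD('m)"
    and T_C1: "\<And>n. continuously_differentiable_on (T n) \<Theta>"
    and J_rank: "rank J = CARD('l)"
    and T_defined: "\<And>K. compact K \<Longrightarrow>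
        vanishing_prob M (\<lambda>n x. \<exists>\<Delta>\<in>K. localize (v n) (\<theta> n x) \<Delta> \<notin> \<Theta>)"
    and T_jacobian: "\<And>K. compact K \<Longrightarrow>
        uniform_limit_in_prob M K
          (\<lambda>n x \<Delta>. jacobian (rescaled_map (w n) (v n) (T n) (\<theta> n x)) (at \<Delta>)) (\<lambda>_. J)"
  shows "tendsto_in_prob M
        (\<lambda>n x. SUP B\<in>sets (borel :: (real^'l) measure).
           \<bar>measure (Post n x) {\<eta>\<in>\<Theta>. w n * (T n \<eta> - T n (\<theta> n x)) \<in> B}
             - measure (mv_normal 0 (J ** D ** transpose J)) B\<bar>) 0"
  unfolding tendsto_in_prob_def
proof (intro allI impI)
  fix e :: real assume e: "e > 0"
  let ?N = "mv_normal 0 D" and ?N' = "mv_normal 0 (J ** D ** transpose J)"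
  let ?d = "\<lambda>n x B. \<bar>measure (Post n x) {\<eta>\<in>\<Theta>. v n * (\<eta> - \<theta> n x) \<in> B} - measure ?N B\<bar>"
  let ?d' = "\<lambda>n x B. \<bar>measure (Post n x) {\<eta>\<in>\<Theta>. w n * (T n \<eta> - T n (\<theta> n x)) \<in> B} - measure ?N' B\<bar>"
  let ?jac = "\<lambda>n x \<Delta>. jacobian (rescaled_map (w n) (v n) (T n) (\<theta> n x)) (at \<Delta>)"
  interpret N: prob_space ?N by (rule prob_space_mv_normal[OF D_pd])
  show "vanishing_prob M (\<lambda>n x. dist (SUP B\<in>sets borel. ?d' n x B) 0 > e)"
  proof (rule delta_method_total_variation[OF D_pd J_rank e], goal_cases)
    case (1 R \<delta>)
    note \<delta> = 1(1) and transfer = 1(2)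
    let ?K = "cball 0 R :: (real^'m) set"
    have bad: "vanishing_prob M (\<lambda>n x. dist (SUP B\<in>sets borel. ?d n x B) 0 > \<delta>)"
      "vanishing_prob M (\<lambda>n x. \<exists>\<Delta>\<in>?K. localize (v n) (\<theta> n x) \<Delta> \<notin> \<Theta>)"
      "vanishing_prob M (\<lambda>n x. \<exists>\<Delta>\<in>?K. dist (?jac n x \<Delta>) J > \<delta>)"
      using BvM T_jacobian[OF compact_cball] \<delta>
      unfolding tendsto_in_prob_def uniform_limit_in_prob_def by (blast, intro T_defined compact_cball, blast)
    show ?case
    proof (rule vanishing_prob_subset_Un[OF vanishing_prob_subset_Un[OF bad(1) bad(2)] bad(3)])
      fix n x
      assume x: "x \<in> space (M n)" and *: "dist (SUP B\<in>sets borel. ?d' n x B) 0 > e"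
      show "((dist (SUP B\<in>sets borel. ?d n x B) 0 > \<delta>) \<or> (\<exists>\<Delta>\<in>?K. localize (v n) (\<theta> n x) \<Delta> \<notin> \<Theta>))
          \<or> (\<exists>\<Delta>\<in>?K. dist (?jac n x \<Delta>) J > \<delta>)"
      proof (rule ccontr)
        assume "\<not> ?thesis"
        then have sup: "\<bar>SUP B\<in>sets borel. ?d n x B\<bar> \<le> \<delta>"
          and loc: "\<And>\<Delta>. \<Delta> \<in> ?K \<Longrightarrow> localize (v n) (\<theta> n x) \<Delta> \<in> \<Theta>"
          and jac: "\<And>\<Delta>. \<Delta> \<in> ?K \<Longrightarrow> dist (?jac n x \<Delta>) J \<le> \<delta>"
          by (auto simp: not_less)
        have P1: "emeasure (Post n x) UNIV \<le> 1"
          unfolding post using x data(2)[of n]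
          by (intro emeasure_posterior_le_1 posterior_density_measurable[OF model prior param])
             (metis sets_eq_imp_space_eq)
        have sP: "sets (Post n x) = sets borel" by (simp add: post)
        have "space (Post n x) = UNIV" using sP sets_eq_imp_space_eq by (metis space_borel)
        then interpret P: finite_measure "Post n x"
          using P1 by (intro finite_measureI) (auto simp: top_unique)
        \<comment> \<open>Boundedness makes the supremum in the hypothesis an upper bound of its members.\<close>
        have "measure (Post n x) A \<le> 1" for A
          using P.bounded_measure[of A] P1 \<open>space (Post n x) = UNIV\<close> by (simp add: P.emeasure_eq_measure)
        then have "?d n x B \<le> 1" for B
          using N.prob_le_1[of B] measure_nonneg[of ?N B] measure_nonneg[of "Post n x"]
          by (smt (verit))
        then have "bdd_above ((\<lambda>B. ?d n x B) ` sets borel)" by (intro bdd_aboveI) auto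
        then have "?d n x A \<le> (SUP B\<in>sets borel. ?d n x B)" if "A \<in> sets borel" for A
          using that by (intro cSUP_upper)
        then have close: "?d n x A \<le> \<delta>" if "A \<in> sets borel" for A
          using that abs_le_D1[OF sup] order_trans by blast
        have le: "?d' n x B \<le> e" if "B \<in> sets borel" for B
          by (rule transfer[OF sP P1 param v_pos T_C1 loc jac close that])
        then have "bdd_above ((\<lambda>B. ?d' n x B) ` sets borel)" by (intro bdd_aboveI) auto
        then have "?d' n x {} \<le> (SUP B\<in>sets borel. ?d' n x B)" by (intro cSUP_upper) auto
        moreover have "(SUP B\<in>sets borel. ?d' n x B) \<le> e" using le by (intro cSUP_least) auto
        ultimately show False using * by (simp add: dist_real_def)
      qed
    qed
  qed
qed

end
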